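(* Let $F$ be a flipclass (an $h$-flipclass of paths from $u$ to $v$ for some $u,v\in\mathfrak S_n$ and $h\in\mathbb N$). Then for any two reflection orderings $\preceq$ and $\preceq'$ of the transpositions of $\mathfrak S_n$, the number of paths in $F$ that are increasing with respect to $\preceq$ equals the number of paths in $F$ that are increasing with respect to $\preceq'$.
   Context: $\mathfrak S_n$ is the symmetric group on $[n]$, $T$ its set of transpositions, $\ell$ the length function w.r.t. simple transpositions $(i,i+1)$. The Bruhat graph $B(\mathfrak S_n)$ is the edge-labelled directed graph on $\mathfrak S_n$ with an edge $x\xrightarrow{t}y$ iff $yx^{-1}=t\in T$ and $\ell(x)<\ell(y)$. $P_h(u,v)$ is the set of paths $u=x_0\to\cdots\to x_h=v$ of length $h$ in $B(\mathfrak S_n)$. Between two fixed vertices there are either $0$ or $2$ paths of length $2$; each is the flip of the other. For $i\in[h-1]$, the $i$-th flip operator $f_i$ on $P_h(u,v)$ replaces the subpath $x_{i-1}\to x_i\to x_{i+1}$ by its flip; the orbits of the group generated by $f_1,\dots,f_{h-1}$ on $P_h(u,v)$ are called ($h$-)flipclasses. A reflection ordering is a total order $\preceq$ on $T$ such that for $a<b<c$ in $[n]$ either $(a,b)\preceq(a,c)\preceq(b,c)$ or $(b,c)\preceq(a,c)\preceq(a,b)$. A path with consecutive edge labels $t_1,\dots,t_h$ is increasing w.r.t. $\preceq$ if $t_1\preceq t_2\preceq\cdots\preceq t_h$. *)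

theory Defs
  imports "HOL-Combinatorics.Combinatorics"
begin

definition sym_group :: "nat \<Rightarrow> (nat \<Rightarrow> nat) set" where
  "sym_group n = {x. x permutes {1..n}}"

definition transpositions :: "nat \<Rightarrow> (nat \<Rightarrow> nat) set" where
  "transpositions n = {transpose a b | a b. 1 \<le> a \<and> a < b \<and> b \<le> n}"

text \<open>Coxeter length w.r.t. the simple transpositions = number of inversions.\<close>
definition perm_length :: "nat \<Rightarrow> (nat \<Rightarrow> nat) \<Rightarrow> nat" where
  "perm_length n x = card {(i, j). 1 \<le> i \<and> i < j \<and> j \<le> n \<and> x j < x i}"

definition bruhat_edge :: "nat \<Rightarrow> (nat \<Rightarrow> nat) \<Rightarrow> (nat \<Rightarrow> nat) \<Rightarrow> bool" where
  "bruhat_edge n x y \<longleftrightarrow> x \<in> sym_group n \<and> y \<in> sym_group n \<and>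
     y \<circ> inv x \<in> transpositions n \<and> perm_length n x < perm_length n y"

definition bruhat_paths :: "nat \<Rightarrow> nat \<Rightarrow> (nat \<Rightarrow> nat) \<Rightarrow> (nat \<Rightarrow> nat) \<Rightarrow> (nat \<Rightarrow> nat) list set" where
  "bruhat_paths n h u v = {p. length p = Suc h \<and> p ! 0 = u \<and> p ! h = v \<and>
     (\<forall>i<h. bruhat_edge n (p ! i) (p ! Suc i))}"

definition path_labels :: "(nat \<Rightarrow> nat) list \<Rightarrow> (nat \<Rightarrow> nat) list" where
  "path_labels p = map (\<lambda>(x, y). y \<circ> inv x) (zip p (tl p))"

definition flip_op :: "nat \<Rightarrow> nat \<Rightarrow> (nat \<Rightarrow> nat) list \<Rightarrow> (nat \<Rightarrow> nat) list" where
  "flip_op n i p = p[i := (THE y. y \<noteq> p ! i \<and> bruhat_edge n (p ! (i - 1)) y \<and>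
                                    bruhat_edge n y (p ! Suc i))]"

text \<open>Generators f_1,...,f_{h-1} acting on P_h(u,v) (each is an involution, so the
  orbits of the generated group are the classes of the reflexive transitive closure).\<close>
definition flip_step :: "nat \<Rightarrow> nat \<Rightarrow> (nat \<Rightarrow> nat) \<Rightarrow> (nat \<Rightarrow> nat) \<Rightarrow>
    ((nat \<Rightarrow> nat) list \<times> (nat \<Rightarrow> nat) list) set" where
  "flip_step n h u v = {(p, flip_op n i p) | p i. p \<in> bruhat_paths n h u v \<and> 1 \<le> i \<and> i \<le> h - 1}"

definition is_flipclass :: "nat \<Rightarrow> nat \<Rightarrow> (nat \<Rightarrow> nat) \<Rightarrow> (nat \<Rightarrow> nat) \<Rightarrow>
    (nat \<Rightarrow> nat) list set \<Rightarrow> bool" where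
  "is_flipclass n h u v F \<longleftrightarrow>
     (\<exists>p \<in> bruhat_paths n h u v. F = {q. (p, q) \<in> (flip_step n h u v)\<^sup>*})"

definition reflection_ordering :: "nat \<Rightarrow> ((nat \<Rightarrow> nat) \<times> (nat \<Rightarrow> nat)) set \<Rightarrow> bool" where
  "reflection_ordering n r \<longleftrightarrow> linear_order_on (transpositions n) r \<and>
     (\<forall>a b c. 1 \<le> a \<and> a < b \<and> b < c \<and> c \<le> n \<longrightarrow>
        ((transpose a b, transpose a c) \<in> r \<and> (transpose a c, transpose b c) \<in> r) \<or>
        ((transpose b c, transpose a c) \<in> r \<and> (transpose a c, transpose a b) \<in> r))"

definition increasing_path :: "((nat \<Rightarrow> nat) \<times> (nat \<Rightarrow> nat)) set \<Rightarrow> (nat \<Rightarrow> nat) list \<Rightarrow> bool" where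
  "increasing_path r p \<longleftrightarrow>
     (\<forall>i. Suc i < length (path_labels p) \<longrightarrow> (path_labels p ! i, path_labels p ! Suc i) \<in> r)"

end

theory Submission
  imports Defs "HOL-Library.Sublist"
begin

text \<open>Write a path from \<open>u\<close> as the word of its edge labels. Listing the transpositions
  in the order given by a reflection ordering, the increasing paths are those whose word is a
  subsequence of the list. Replacing a segment \<open>(b,c), (a,c), (a,b)\<close> of the list by its
  reverse, or exchanging adjacent commuting transpositions, does not change the number of such
  words in a flipclass: words in the segment with given start, length and product are unique, and
  each is turned into a word in the reversed segment by flips (a Yang-Baxter relation). By such
  moves every reflection ordering is brought to one normal form, by induction on \<open>n\<close>: first
  move all \<open>(a,n)\<close> to the end, where their order is then forced.\<close>

section \<open>Edges of the Bruhat graph\<close>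

text \<open>Being increasing is a condition on a whole word, whereas a flip changes two neighbouring
  letters. The two meet because a move of the list alters it only inside a segment: a subsequence of
  \<open>P @ M @ Q\<close> splits into parts from \<open>P\<close>, \<open>M\<close> and
  \<open>Q\<close>, and only the middle part has to be replaced. Flips keep the product and the
  length of that part, so the replacement is injective although the flips leading to it are chosen
  arbitrarily; injections in both directions then give equality without an explicit bijection. A
  flipclass enters this argument through its closure under flips. Everything local rests on one fact
  about 3-cycles: such a permutation has three factorizations into two transpositions, and from a
  given vertex either exactly two of them ascend or none does.\<close>

lemma perm_length_less_transpose:
  assumes x: "x permutes {1..n}" and ij: "1 \<le> i" "i < j" "j \<le> n" and less: "x i < x j"
  shows "perm_length n x < perm_length n (x \<circ> transpose i j)"
proof -
  define \<tau> where "\<tau> = transpose i j"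
  define y where "y = x \<circ> \<tau>"
  let ?I = "\<lambda>z. {(k, l). 1 \<le> k \<and> k < l \<and> l \<le> n \<and> z l < (z k :: nat)}"
  \<comment> \<open>An inversion of \<open>x\<close> is carried along with the swapped positions,
    where \<open>y\<close> takes the same two values. If \<open>\<tau>\<close> reverses the pair,
    then one of its positions is \<open>i\<close> or \<open>j\<close> and the other lies strictly
    between them, as \<open>(i, j)\<close> is no inversion of \<open>x\<close>; the pair is kept and
    stays an inversion because \<open>x i < x j\<close>. The image misses \<open>(i, j)\<close>,
    hence the strict increase.\<close>
  define f where "f = (\<lambda>(k, l). if \<tau> k < \<tau> l then (\<tau> k, \<tau> l) else (k, l))"
  have fin: "finite (?I y)"
    by (rule finite_subset[of _ "{1..n} \<times> {1..n}"]) auto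
  have inv: "\<tau> (\<tau> k) = k" for k by (simp add: \<tau>_def)
  have inj: "inj_on f (?I x)"
    unfolding inj_on_def f_def by (auto simp: inv split: if_splits) (metis inv)+
  have rng: "\<tau> k \<in> {1..n} \<longleftrightarrow> k \<in> {1..n}" for k
    using ij by (auto simp: \<tau>_def transpose_def)
  have sub: "f ` ?I x \<subseteq> ?I y - {(i, j)}"
  proof
    fix q assume "q \<in> f ` ?I x"
    then obtain k l where kl: "1 \<le> k" "k < l" "l \<le> n" "x l < x k" and q: "q = f (k, l)" by auto
    show "q \<in> ?I y - {(i, j)}"
    proof (cases "\<tau> k < \<tau> l")
      case True
      moreover have "\<tau> k \<in> {1..n}" "\<tau> l \<in> {1..n}" using kl rng by auto
      moreover have "(\<tau> k, \<tau> l) \<noteq> (i, j)"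
        using kl ij by (metis \<tau>_def inv not_less_iff_gr_or_eq prod.inject transpose_apply_first transpose_apply_second)
      ultimately show ?thesis using kl q by (auto simp: f_def y_def inv)
    next
      case False
      then have "q = (k, l)" using q by (simp add: f_def)
      moreover have "y l < y k \<and> (k, l) \<noteq> (i, j)"
        using False kl ij less by (auto simp: y_def \<tau>_def transpose_def split: if_splits)
      ultimately show ?thesis using kl by auto
    qed
  qed
  have "(i, j) \<in> ?I y" using ij less by (simp add: y_def \<tau>_def)
  then have "?I y - {(i, j)} \<subset> ?I y" by blast
  then have "f ` ?I x \<subset> ?I y" using sub by blast
  then have "card (f ` ?I x) < card (?I y)" using fin by (rule psubset_card_mono[rotated])
  then show ?thesis
    unfolding perm_length_def card_image[OF inj] y_def \<tau>_def .
qed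

text \<open>Labels are handled as pairs, since the lists and filters below read off the two entries
  of a transposition; on these pairs \<open>tr\<close> is injective.\<close>

definition transposition_pairs :: "nat \<Rightarrow> (nat \<times> nat) set" where
  "transposition_pairs n = {(a, b). 1 \<le> a \<and> a < b \<and> b \<le> n}"

definition tr :: "nat \<times> nat \<Rightarrow> nat \<Rightarrow> nat" where
  "tr t = transpose (fst t) (snd t)"

lemma tr_simp [simp]: "tr (a, b) = transpose a b"
  by (simp add: tr_def)

lemma bij_tr [simp]: "bij (tr t)" 
  by (simp add: tr_def)

lemma tr_tr [simp]: "tr t \<circ> tr t = id"
  by (simp add: tr_def)

lemma inv_tr [simp]: "inv (tr t) = tr t"
  using inv_unique_comp[OF tr_tr tr_tr] .

lemma transpositions_eq_image: "transpositions n = tr ` transposition_pairs n"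
  by (force simp: transpositions_def transposition_pairs_def)

lemma inj_on_tr: "inj_on tr (transposition_pairs n)"
proof -
  have "a = c \<and> b = d" if "a < b" "c < d" "transpose a b = transpose c d" for a b c d :: nat
  proof -
    have "transpose c d a = b" "transpose c d b = a" using that(3) by (metis transpose_apply_first transpose_apply_second)+
    then show ?thesis using that(1,2) by (auto simp: transpose_def split: if_splits)
  qed
  then show ?thesis by (auto simp: inj_on_def transposition_pairs_def)
qed

lemma finite_transposition_pairs: "finite (transposition_pairs n)"
  by (rule finite_subset[of _ "{1..n} \<times> {1..n}"]) (auto simp: transposition_pairs_def)

lemma tr_permutes: "t \<in> transposition_pairs n \<Longrightarrow> tr t permutes {1..n}"
  by (auto simp: transposition_pairs_def intro!: permutes_swap_id)

text \<open>Exchanging the values \<open>a\<close> and \<open>b\<close> on the left is exchanging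
  their positions \<open>inv x a\<close> and \<open>inv x b\<close> on the right. The converse
  implication applies the same estimate to \<open>tr (a, b) \<circ> x\<close>, where the two
  positions come in the other order.\<close>

lemma perm_length_less_tr_iff:
  assumes x: "x permutes {1..n}" and t: "(a, b) \<in> transposition_pairs n"
  shows "perm_length n x < perm_length n (tr (a, b) \<circ> x) \<longleftrightarrow> inv x a < inv x b"
proof -
  have ab: "1 \<le> a" "a < b" "b \<le> n" using t by (auto simp: transposition_pairs_def)
  have up: "perm_length n x < perm_length n (tr (a, b) \<circ> x)"
    if x: "x permutes {1..n}" and less: "inv x a < inv x b" for x
  proof -
    have rng: "inv x a \<in> {1..n}" "inv x b \<in> {1..n}"
      using ab permutes_in_image[OF permutes_inv[OF x]] by auto
    have bx: "bij x" using x by (rule permutes_bij)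
    have "x (inv x a) = a" "x (inv x b) = b" using permutes_inverses[OF x] by auto
    moreover have "tr (a, b) \<circ> x = x \<circ> transpose (inv x a) (inv x b)"
      using transpose_comp_eq[OF bx] by simp
    ultimately show ?thesis
      using perm_length_less_transpose[OF x _ less] rng ab by auto
  qed
  have ne: "inv x a \<noteq> inv x b"
    using ab permutes_inj[OF permutes_inv[OF x]] by (auto dest: injD)
  show ?thesis
  proof
    assume *: "perm_length n x < perm_length n (tr (a, b) \<circ> x)"
    show "inv x a < inv x b"
    proof (rule ccontr)
      assume "\<not> inv x a < inv x b"
      then have gt: "inv x b < inv x a" using ne by simp
      let ?y = "tr (a, b) \<circ> x"
      have y: "?y permutes {1..n}"
        using permutes_compose[OF x tr_permutes[OF t]] .
      have "inv ?y = inv x \<circ> tr (a, b)"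
        using o_inv_distrib[OF bij_tr permutes_bij[OF x], of "(a, b)"] by (simp only: inv_tr)
      then have "inv ?y a < inv ?y b" using gt by simp
      from up[OF y this] have "perm_length n ?y < perm_length n (tr (a, b) \<circ> ?y)" .
      moreover have "tr (a, b) \<circ> ?y = x" by (metis comp_assoc fun.map_id0 id_apply id_comp tr_tr)
      ultimately show False using * by simp
    qed
  qed (use up[OF x] in auto)
qed

lemma bruhat_edge_iff:
  "bruhat_edge n x y \<longleftrightarrow> x permutes {1..n} \<and>
     (\<exists>t \<in> transposition_pairs n. y = tr t \<circ> x \<and> inv x (fst t) < inv x (snd t))"
proof
  assume e: "bruhat_edge n x y"
  then have x: "x permutes {1..n}" by (simp add: bruhat_edge_def sym_group_def)
  from e obtain t where t: "t \<in> transposition_pairs n" "y \<circ> inv x = tr t"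
    by (auto simp: bruhat_edge_def transpositions_eq_image)
  have "y = (y \<circ> inv x) \<circ> x"
    using permutes_inv_o(2)[OF x] by (simp add: comp_assoc)
  then have y: "y = tr t \<circ> x" using t by simp
  then show "x permutes {1..n} \<and>
     (\<exists>t \<in> transposition_pairs n. y = tr t \<circ> x \<and> inv x (fst t) < inv x (snd t))"
    using x t e perm_length_less_tr_iff[OF x, of "fst t" "snd t"] by (auto simp: bruhat_edge_def)
next
  assume "x permutes {1..n} \<and>
     (\<exists>t \<in> transposition_pairs n. y = tr t \<circ> x \<and> inv x (fst t) < inv x (snd t))"
  then obtain t where x: "x permutes {1..n}" and t: "t \<in> transposition_pairs n" "y = tr t \<circ> x"
    and less: "inv x (fst t) < inv x (snd t)" by blast
  have "y \<circ> inv x = tr t" using t permutes_inv_o(1)[OF x] by (simp add: comp_assoc)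
  then show "bruhat_edge n x y"
    using x t less permutes_compose[OF x tr_permutes[OF t(1)]]
      perm_length_less_tr_iff[OF x, of "fst t" "snd t"]
    by (auto simp: bruhat_edge_def transpositions_eq_image sym_group_def)
qed

section \<open>Words of labels and flips\<close>

text \<open>A vertex \<open>x\<close> enters through \<open>w = inv x\<close>, the positions of the values: the
  edge labelled \<open>(a,b)\<close> leaves \<open>x\<close> iff \<open>w a < w b\<close> and leads to \<open>w \<circ> tr (a,b)\<close>.
  Hence \<open>word_prod\<close> is the inverse of the product of the labels along a path.\<close>

fun word_prod :: "(nat \<times> nat) list \<Rightarrow> nat \<Rightarrow> nat" where
  "word_prod [] = id"
| "word_prod (t # g) = tr t \<circ> word_prod g"

fun ascending :: "(nat \<Rightarrow> nat) \<Rightarrow> (nat \<times> nat) list \<Rightarrow> bool" where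
  "ascending w [] \<longleftrightarrow> True"
| "ascending w (t # g) \<longleftrightarrow> w (fst t) < w (snd t) \<and> ascending (w \<circ> tr t) g"

lemma word_prod_append: "word_prod (g @ h) = word_prod g \<circ> word_prod h"
  by (induction g) (simp_all add: comp_assoc)

lemma ascending_append: "ascending w (g @ h) \<longleftrightarrow> ascending w g \<and> ascending (w \<circ> word_prod g) h"
  by (induction g arbitrary: w) (simp_all add: comp_assoc)

lemma bij_word_prod: "bij (word_prod g)"
proof (induction g)
  case (Cons t g)
  then show ?case using bij_comp[OF Cons bij_tr] by (simp only: word_prod.simps)
qed (simp add: bij_id[unfolded id_def])

text \<open>For words of paths, \<open>flip_exists_unique\<close> leaves for \<open>[s', t']\<close>
  only the old pair and its flip, so this is closure under flips without a choice operator.\<close>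

definition flip_closed :: "nat \<Rightarrow> (nat \<Rightarrow> nat) \<Rightarrow> (nat \<times> nat) list set \<Rightarrow> bool" where
  "flip_closed n w G \<longleftrightarrow> (\<forall>A s t s' t' B. A @ [s, t] @ B \<in> G \<longrightarrow>
     s' \<in> transposition_pairs n \<longrightarrow> t' \<in> transposition_pairs n \<longrightarrow>
     word_prod [s', t'] = word_prod [s, t] \<longrightarrow> ascending (w \<circ> word_prod A) [s', t'] \<longrightarrow>
     A @ [s', t'] @ B \<in> G)"

section \<open>Factorizations of a product of two transpositions\<close>

lemma support_word_prod2:
  assumes "s \<in> transposition_pairs n" "t \<in> transposition_pairs n" "s \<noteq> t"
  shows "{x. word_prod [s, t] x \<noteq> x} = {fst s, snd s, fst t, snd t}"
proof -
  \<comment> \<open>Two different transpositions agree exactly at the points that neither of them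
    moves. So the product determines the set of points involved, which confines every other
    factorization.\<close>
  have "tr s x = tr t x \<longleftrightarrow> x \<notin> {fst s, snd s, fst t, snd t}" for x
  proof -
    obtain a b c d where st: "s = (a, b)" "t = (c, d)" by (metis surj_pair)
    then have "a < b" "c < d" "a \<noteq> c \<or> b \<noteq> d"
      using assms by (auto simp: transposition_pairs_def)
    then consider "x \<notin> {a, b, c, d}" | "x = a" | "x = b" | "x = c" | "x = d" by blast
    then show ?thesis
      using \<open>a < b\<close> \<open>c < d\<close> \<open>a \<noteq> c \<or> b \<noteq> d\<close> by cases (auto simp: st transpose_def)
  qed
  moreover have "tr s (tr t x) = x \<longleftrightarrow> tr s x = tr t x" for x
    by (metis comp_apply id_apply tr_tr)
  ultimately show ?thesis by auto
qed

lemma word_prod2_neq_id: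
  assumes "s \<in> transposition_pairs n" "t \<in> transposition_pairs n" "s \<noteq> t"
  shows "word_prod [s, t] \<noteq> id"
proof
  assume "word_prod [s, t] = id"
  then show False using support_word_prod2[OF assms] by (simp del: word_prod.simps)
qed

text \<open>The two products are the 3-cycles on \<open>{a, b, c}\<close>, told apart by the image
  of \<open>a\<close>; the six ordered pairs of transpositions of the triple fall into two classes
  of three.\<close>

lemma word_prod_triple:
  assumes "a < b" "b < (c :: nat)"
  shows "word_prod [(a, c), (b, c)] = word_prod [(a, b), (a, c)]"
    and "word_prod [(b, c), (a, b)] = word_prod [(a, b), (a, c)]"
    and "word_prod [(a, b), (b, c)] = word_prod [(a, c), (a, b)]"
    and "word_prod [(b, c), (a, c)] = word_prod [(a, c), (a, b)]"
    and "word_prod [(a, c), (a, b)] \<noteq> word_prod [(a, b), (a, c)]"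
proof -
  show "word_prod [(a, c), (b, c)] = word_prod [(a, b), (a, c)]"
    and "word_prod [(b, c), (a, b)] = word_prod [(a, b), (a, c)]"
    and "word_prod [(a, b), (b, c)] = word_prod [(a, c), (a, b)]"
    and "word_prod [(b, c), (a, c)] = word_prod [(a, c), (a, b)]"
    using assms by (auto simp: fun_eq_iff transpose_def)
  have "word_prod [(a, c), (a, b)] a \<noteq> word_prod [(a, b), (a, c)] a"
    using assms by (auto simp: transpose_def)
  then show "word_prod [(a, c), (a, b)] \<noteq> word_prod [(a, b), (a, c)]" by metis
qed

text \<open>The product moves four points, so \<open>s'\<close> and \<open>t'\<close> are disjoint
  as well; they must then be the two 2-cycles of the product, in one of the two orders.\<close>

lemma disjoint_flip:
  assumes s: "s \<in> transposition_pairs n" and t: "t \<in> transposition_pairs n"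
    and disj: "{fst s, snd s} \<inter> {fst t, snd t} = {}"
    and s': "s' \<in> transposition_pairs n" and t': "t' \<in> transposition_pairs n"
  shows "word_prod [s', t'] = word_prod [s, t] \<longleftrightarrow> (s', t') = (s, t) \<or> (s', t') = (t, s)"
proof
  assume eq: "word_prod [s', t'] = word_prod [s, t]"
  have ne: "s \<noteq> t" using disj by auto
  have ne': "s' \<noteq> t'" using eq word_prod2_neq_id[OF s t ne] by auto
  have supp: "{fst s', snd s', fst t', snd t'} = {fst s, snd s, fst t, snd t}"
    using support_word_prod2[OF s t ne] support_word_prod2[OF s' t' ne', unfolded eq] by (rule trans[OF sym, rotated])
  obtain a b c d where st: "s = (a, b)" "t = (c, d)" by (metis surj_pair)
  obtain e f g h where st': "s' = (e, f)" "t' = (g, h)" by (metis surj_pair)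
  have dist: "a < b" "c < d" "a \<noteq> c" "a \<noteq> d" "b \<noteq> c" "b \<noteq> d" "e < f" "g < h"
    using s t s' t' disj by (auto simp: st st' transposition_pairs_def)
  have "card {e, f, g, h} = 4" using supp dist by (simp add: st st')
  then have dist': "e \<noteq> g" "e \<noteq> h" "f \<noteq> g" "f \<noteq> h"
    using dist(7,8) by (auto simp: card_insert_if split: if_splits)
  have "word_prod [s', t'] a = b" "word_prod [s', t'] c = d"
    unfolding eq using dist by (simp_all add: st)
  moreover have "{x, y} = {e, f} \<or> {x, y} = {g, h}"
    if "word_prod [s', t'] x = y" "x \<in> {e, f, g, h}" for x y
  proof -
    have "transpose e f (transpose g h x) = y" using that by (simp add: st')
    moreover have "x = e \<or> x = f \<or> x = g \<or> x = h" using that by blast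
    ultimately have "y = transpose e f x \<and> x \<in> {e, f} \<or> y = transpose g h x \<and> x \<in> {g, h}"
      using dist' by (metis insertCI transpose_apply_first transpose_apply_second transpose_apply_other)
    then show ?thesis by auto
  qed
  moreover have "a \<in> {e, f, g, h}" "c \<in> {e, f, g, h}" using supp by (auto simp: st st')
  ultimately have "{a, b} = {e, f} \<or> {a, b} = {g, h}" "{c, d} = {e, f} \<or> {c, d} = {g, h}"
    by blast+
  moreover have "{a, b} \<noteq> {c, d}" using dist by (auto simp: doubleton_eq_iff)
  ultimately have "{a, b} = {e, f} \<and> {c, d} = {g, h} \<or> {a, b} = {g, h} \<and> {c, d} = {e, f}"
    by metis
  then show "(s', t') = (s, t) \<or> (s', t') = (t, s)"
  proof -
    have order: "(p, q) = (x, y)" if "{x, y} = {p, q}" "x < y" "p < q" for x y p q :: nat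
      using that by (auto simp: doubleton_eq_iff)
    show ?thesis if "{a, b} = {e, f} \<and> {c, d} = {g, h} \<or> {a, b} = {g, h} \<and> {c, d} = {e, f}"
      using that order[of a b e f] order[of c d g h] order[of a b g h] order[of c d e f] dist(1,2,7,8)
      unfolding st st' by blast
  qed
next
  assume "(s', t') = (s, t) \<or> (s', t') = (t, s)"
  then show "word_prod [s', t'] = word_prod [s, t]"
    using disj by (cases s; cases t) (auto simp: fun_eq_iff transpose_def)
qed

lemma overlapping_pairs:
  assumes s: "s \<in> transposition_pairs n" and t: "t \<in> transposition_pairs n" "s \<noteq> t"
    and "{fst s, snd s} \<inter> {fst t, snd t} \<noteq> {}"
  obtains a b c where "1 \<le> a" "a < b" "b < c" "c \<le> n"
    "s \<in> {(a, b), (a, c), (b, c)}" "t \<in> {(a, b), (a, c), (b, c)}"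
proof -
  have "\<exists>a b c. 1 \<le> a \<and> a < b \<and> b < c \<and> c \<le> n \<and>
    s \<in> {(a, b), (a, c), (b, c)} \<and> t \<in> {(a, b), (a, c), (b, c)}"
  proof -
    obtain a b c d where st: "s = (a, b)" "t = (c, d)" by (metis surj_pair)
    then have d: "1 \<le> a" "1 \<le> c" "a < b" "c < d" "b \<le> n" "d \<le> n" "(a, b) \<noteq> (c, d)"
      using s t by (auto simp: transposition_pairs_def)
    have "a = c \<or> a = d \<or> b = c \<or> b = d" using assms by (auto simp: st)
    then consider "a = c" "b < d" | "a = c" "d < b" | "a = d" | "b = c" | "b = d" "a < c" | "b = d" "c < a"
      using d by (metis linorder_neqE_nat)
    then show ?thesis
    proof cases
      case 1
      then show ?thesis using d st by (intro exI[of _ a] exI[of _ b] exI[of _ d]) auto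
    next
      case 2
      then show ?thesis using d st by (intro exI[of _ a] exI[of _ d] exI[of _ b]) auto
    next
      case 3
      then show ?thesis using d st by (intro exI[of _ c] exI[of _ a] exI[of _ b]) auto
    next
      case 4
      then show ?thesis using d st by (intro exI[of _ a] exI[of _ b] exI[of _ d]) auto
    next
      case 5
      then show ?thesis using d st by (intro exI[of _ a] exI[of _ c] exI[of _ b]) auto
    next
      case 6
      then show ?thesis using d st by (intro exI[of _ c] exI[of _ a] exI[of _ b]) auto
    qed
  qed
  then show ?thesis using that by blast
qed

lemma pairs_in_triple:
  assumes "a < b" "b < (c :: nat)" "e < f" "{e, f} \<subseteq> {a, b, c}"
  shows "(e, f) \<in> {(a, b), (a, c), (b, c)}"
  using assms by auto

lemma triple_flip_closed:
  assumes abc: "1 \<le> a" "a < b" "b < c" "c \<le> n"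
    and "s \<in> {(a, b), (a, c), (b, c)}" "t \<in> {(a, b), (a, c), (b, c)}" "s \<noteq> t"
    and s': "s' \<in> transposition_pairs n" and t': "t' \<in> transposition_pairs n"
    and eq: "word_prod [s', t'] = word_prod [s, t]"
  shows "s' \<in> {(a, b), (a, c), (b, c)} \<and> t' \<in> {(a, b), (a, c), (b, c)} \<and> s' \<noteq> t'"
proof -
  have st: "s \<in> transposition_pairs n" "t \<in> transposition_pairs n"
    using assms by (auto simp: transposition_pairs_def)
  have ne': "s' \<noteq> t'" using eq word_prod2_neq_id[OF st] assms by auto
  have "{fst s', snd s', fst t', snd t'} = {fst s, snd s, fst t, snd t}"
    using support_word_prod2[OF st \<open>s \<noteq> t\<close>] support_word_prod2[OF s' t' ne', unfolded eq] by (rule trans[OF sym, rotated])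
  then have sub: "{fst s', snd s', fst t', snd t'} \<subseteq> {a, b, c}" using assms(5,6) by auto
  have "(fst s', snd s') \<in> {(a, b), (a, c), (b, c)}"
    by (rule pairs_in_triple[OF abc(2,3)]) (use s' sub in \<open>auto simp: transposition_pairs_def\<close>)
  moreover have "(fst t', snd t') \<in> {(a, b), (a, c), (b, c)}"
    by (rule pairs_in_triple[OF abc(2,3)]) (use t' sub in \<open>auto simp: transposition_pairs_def\<close>)
  ultimately show ?thesis using ne' by simp
qed

lemma ascending_triple:
  assumes "a < b" "b < (c :: nat)"
  shows "ascending w [(a, b), (a, c)] \<longleftrightarrow> w a < w b \<and> w b < w c"
    and "ascending w [(a, c), (b, c)] \<longleftrightarrow> w a < w c \<and> w b < w a"
    and "ascending w [(b, c), (a, b)] \<longleftrightarrow> w b < w c \<and> w a < w c"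
    and "ascending w [(a, c), (a, b)] \<longleftrightarrow> w a < w c \<and> w c < w b"
    and "ascending w [(a, b), (b, c)] \<longleftrightarrow> w a < w b \<and> w a < w c"
    and "ascending w [(b, c), (a, c)] \<longleftrightarrow> w b < w c \<and> w a < w b"
  using assms by (simp_all add: transpose_def)

text \<open>\<open>C1\<close> and \<open>C2\<close> list the factorizations of the two 3-cycles. The
  support keeps every other factorization within the triple, and the product tells the two classes
  apart.\<close>

lemma triple_flip:
  assumes abc: "1 \<le> a" "a < b" "b < c" "c \<le> n"
    and st: "s \<in> {(a, b), (a, c), (b, c)}" "t \<in> {(a, b), (a, c), (b, c)}" "s \<noteq> t"
  defines "C1 \<equiv> {((a, b), (a, c)), ((a, c), (b, c)), ((b, c), (a, b))}"
  defines "C2 \<equiv> {((a, c), (a, b)), ((a, b), (b, c)), ((b, c), (a, c))}"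
  shows "(s' \<in> transposition_pairs n \<and> t' \<in> transposition_pairs n \<and>
      word_prod [s', t'] = word_prod [s, t]) \<longleftrightarrow>
    (s', t') \<in> (if (s, t) \<in> C1 then C1 else C2)" (is "?L \<longleftrightarrow> ?R")
proof -
  let ?\<alpha> = "word_prod [(a, b), (a, c)]" and ?\<beta> = "word_prod [(a, c), (a, b)]"
  have C: "(e, f) \<in> C1 \<and> (e, f) \<notin> C2 \<and> word_prod [e, f] = ?\<alpha> \<or>
      (e, f) \<notin> C1 \<and> (e, f) \<in> C2 \<and> word_prod [e, f] = ?\<beta>"
    if "e \<in> {(a, b), (a, c), (b, c)} \<and> f \<in> {(a, b), (a, c), (b, c)} \<and> e \<noteq> f" for e f
    using that abc word_prod_triple(1-4)[OF abc(2,3)]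
    unfolding C1_def C2_def by (auto simp del: word_prod.simps)
  have sub: "s' \<in> transposition_pairs n \<and> t' \<in> transposition_pairs n \<and>
      s' \<in> {(a, b), (a, c), (b, c)} \<and> t' \<in> {(a, b), (a, c), (b, c)} \<and> s' \<noteq> t'" if ?R
    using that abc by (auto simp: C1_def C2_def transposition_pairs_def split: if_splits)
  note ne = word_prod_triple(5)[OF abc(2,3)]
  have Cs: "(s, t) \<in> C1 \<and> (s, t) \<notin> C2 \<and> word_prod [s, t] = ?\<alpha> \<or>
      (s, t) \<notin> C1 \<and> (s, t) \<in> C2 \<and> word_prod [s, t] = ?\<beta>" using C st by blast
  show ?thesis
  proof
    assume ?L
    then have "s' \<in> {(a, b), (a, c), (b, c)} \<and> t' \<in> {(a, b), (a, c), (b, c)} \<and> s' \<noteq> t'"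
      using triple_flip_closed[OF abc st] by blast
    from C[OF this] Cs ne \<open>?L\<close> show ?R by (metis (full_types))
  next
    assume R: ?R
    with sub have "s' \<in> {(a, b), (a, c), (b, c)} \<and> t' \<in> {(a, b), (a, c), (b, c)} \<and> s' \<noteq> t'" by blast
    from C[OF this] Cs R have "word_prod [s', t'] = word_prod [s, t]" by (auto simp del: word_prod.simps split: if_splits)
    with sub[OF R] show ?L by blast
  qed
qed

text \<open>This makes flips well defined. Disjoint transpositions can be exchanged. For an
  overlapping pair, two of the three factorizations in \<open>?C1\<close> ascend if
  \<open>w c\<close> is the largest of \<open>w a, w b, w c\<close>, and none otherwise; for
  \<open>?C2\<close> the same holds with \<open>w a\<close> the smallest.\<close>

lemma flip_exists_unique:
  assumes w: "inj w" and s: "s \<in> transposition_pairs n" and t: "t \<in> transposition_pairs n"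
    and asc: "ascending w [s, t]"
  shows "\<exists>!q. fst q \<in> transposition_pairs n \<and> snd q \<in> transposition_pairs n \<and>
     word_prod [fst q, snd q] = word_prod [s, t] \<and> ascending w [fst q, snd q] \<and> q \<noteq> (s, t)"
    (is "\<exists>!q. ?P q")
proof -
  have ne: "s \<noteq> t" using asc s by (auto simp: transposition_pairs_def)
  show ?thesis
  proof (cases "{fst s, snd s} \<inter> {fst t, snd t} = {}")
    case True
    have "ascending w [t, s]"
      using asc True by (cases s; cases t) (auto simp: transpose_def split: if_splits)
    then have "?P (t, s)"
      using ne s t disjoint_flip[OF s t True t s] by (simp del: word_prod.simps ascending.simps)
    moreover have "q = (t, s)" if "?P q" for q
      using that disjoint_flip[OF s t True, of "fst q" "snd q"] by (metis prod.collapse)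
    ultimately show ?thesis by blast
  next
    case False
    then obtain a b c where abc: "1 \<le> a" "a < b" "b < c" "c \<le> n"
      and st: "s \<in> {(a, b), (a, c), (b, c)}" "t \<in> {(a, b), (a, c), (b, c)}"
      using overlapping_pairs[OF s t ne] by metis
    have d: "w a \<noteq> w b" "w a \<noteq> w c" "w b \<noteq> w c"
      using abc by (auto simp: inj_eq[OF w])
    let ?C1 = "{((a, b), (a, c)), ((a, c), (b, c)), ((b, c), (a, b))}"
    let ?C2 = "{((a, c), (a, b)), ((a, b), (b, c)), ((b, c), (a, c))}"
    have P: "?P q \<longleftrightarrow> q \<in> (if (s, t) \<in> ?C1 then ?C1 else ?C2) \<and> ascending w [fst q, snd q] \<and> q \<noteq> (s, t)" for q
      using triple_flip[OF abc st ne, of "fst q" "snd q"] unfolding prod.collapse by blast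
    note asc3 = ascending_triple[OF abc(2,3), of w]
    have distinct: "(a, b) \<noteq> (a, c)" "(a, b) \<noteq> (b, c)" "(a, c) \<noteq> (b, c)"
      using abc by auto
    have two: "\<exists>!q. q \<in> {x, y, z} \<and> A q \<and> q \<noteq> p"
      if "x \<noteq> y" "x \<noteq> z" "y \<noteq> z" "p \<in> {x, y, z}" "A p"
        "A x \<and> A y \<and> \<not> A z \<or> A x \<and> \<not> A y \<and> A z \<or> \<not> A x \<and> A y \<and> A z \<or> \<not> A x \<and> \<not> A y \<and> \<not> A z"
      for x y z p and A :: "(nat \<times> nat) \<times> (nat \<times> nat) \<Rightarrow> bool"
      using that by auto
    let ?A = "\<lambda>q. ascending w [fst q, snd q]"
    have order:
      "?A ((a, b), (a, c)) \<and> ?A ((a, c), (b, c)) \<and> \<not> ?A ((b, c), (a, b)) \<or>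
        ?A ((a, b), (a, c)) \<and> \<not> ?A ((a, c), (b, c)) \<and> ?A ((b, c), (a, b)) \<or>
        \<not> ?A ((a, b), (a, c)) \<and> ?A ((a, c), (b, c)) \<and> ?A ((b, c), (a, b)) \<or>
        \<not> ?A ((a, b), (a, c)) \<and> \<not> ?A ((a, c), (b, c)) \<and> \<not> ?A ((b, c), (a, b))"
      "?A ((a, c), (a, b)) \<and> ?A ((a, b), (b, c)) \<and> \<not> ?A ((b, c), (a, c)) \<or>
        ?A ((a, c), (a, b)) \<and> \<not> ?A ((a, b), (b, c)) \<and> ?A ((b, c), (a, c)) \<or>
        \<not> ?A ((a, c), (a, b)) \<and> ?A ((a, b), (b, c)) \<and> ?A ((b, c), (a, c)) \<or>
        \<not> ?A ((a, c), (a, b)) \<and> \<not> ?A ((a, b), (b, c)) \<and> \<not> ?A ((b, c), (a, c))"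
      unfolding fst_conv snd_conv asc3 using d by linarith+
    show ?thesis
    proof (cases "(s, t) \<in> ?C1")
      case True
      show ?thesis unfolding P if_P[OF True]
      proof (rule two)
        show "(s, t) \<in> ?C1" by (rule True)
        show "ascending w [fst (s, t), snd (s, t)]" using asc by (simp only: fst_conv snd_conv)
      qed ((use distinct in blast)+, rule order(1))
    next
      case F: False
      then have C2: "(s, t) \<in> ?C2" using st ne by auto
      show ?thesis unfolding P if_not_P[OF F]
      proof (rule two)
        show "(s, t) \<in> ?C2" by (rule C2)
        show "ascending w [fst (s, t), snd (s, t)]" using asc by (simp only: fst_conv snd_conv)
      qed ((use distinct in blast)+, rule order(2))
    qed
  qed
qed

section \<open>Exchanging the order of a segment\<close>

text \<open>Serves words inside a segment, where no flipclass is at hand: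
  \<open>flip_equiv_append\<close> carries the rewriting into a surrounding word, and
  \<open>flip_closedD\<close> then into \<open>G\<close>.\<close>

inductive flip_equiv :: "nat \<Rightarrow> (nat \<Rightarrow> nat) \<Rightarrow> (nat \<times> nat) list \<Rightarrow> (nat \<times> nat) list \<Rightarrow> bool"
  for n w g where
  refl: "flip_equiv n w g g"
| step: "\<lbrakk>flip_equiv n w g (A @ [s, t] @ B); s' \<in> transposition_pairs n; t' \<in> transposition_pairs n;
    word_prod [s', t'] = word_prod [s, t]; ascending (w \<circ> word_prod A) [s', t']\<rbrakk> \<Longrightarrow>
    flip_equiv n w g (A @ [s', t'] @ B)"

lemma flip_equiv_flip:
  assumes "s' \<in> transposition_pairs n" "t' \<in> transposition_pairs n"
    "word_prod [s', t'] = word_prod [s, t]" "ascending (w \<circ> word_prod A) [s', t']"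
  shows "flip_equiv n w (A @ [s, t] @ B) (A @ [s', t'] @ B)"
  using flip_equiv.step[OF flip_equiv.refl assms] .

lemma word_prod_flip:
  assumes "word_prod [s', t'] = word_prod [s, t]"
  shows "word_prod (A @ [s', t'] @ B) = word_prod (A @ [s, t] @ B)"
  using assms by (simp only: word_prod_append)

lemma ascending_flip:
  assumes "ascending w (A @ [s, t] @ B)"
    "word_prod [s', t'] = word_prod [s, t]" "ascending (w \<circ> word_prod A) [s', t']"
  shows "ascending w (A @ [s', t'] @ B)"
  using assms by (simp only: ascending_append)

lemma flip_equiv_invariants:
  assumes "flip_equiv n w g g'"
  shows "word_prod g' = word_prod g \<and> length g' = length g \<and> (ascending w g \<longrightarrow> ascending w g')"
  using assms
proof induction
  case (step A s t B s' t')
  then show ?case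
    using word_prod_flip[of s' t' s t A B] ascending_flip[of w A s t B s' t'] by simp
qed simp

lemma flip_equiv_append:
  assumes "flip_equiv n (w \<circ> word_prod A) m m'"
  shows "flip_equiv n w (A @ m @ B) (A @ m' @ B)"
  using assms
proof induction
  case (step A' s t B' s' t')
  have "flip_equiv n w (A @ m @ B) ((A @ A') @ [s, t] @ (B' @ B))" using step by simp
  from flip_equiv.step[OF this step(2-4)] step(5) show ?case
    by (simp add: word_prod_append comp_assoc)
qed (rule flip_equiv.refl)

lemma flip_closedD:
  assumes "flip_equiv n w g g'" "flip_closed n w G" "g \<in> G"
  shows "g' \<in> G"
  using assms(1)
proof induction
  case (step A s t B s' t')
  then show ?case using assms(2) unfolding flip_closed_def by blast
qed (rule assms(3))

text \<open>The length belongs to the data: in a braid segment the words \<open>[x, y, z]\<close>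
  and \<open>[y]\<close> have the same product, and both can ascend from the same
  \<open>w\<close>.\<close>

definition unique_words :: "(nat \<times> nat) list \<Rightarrow> bool" where
  "unique_words M \<longleftrightarrow> (\<forall>w m1 m2. subseq m1 M \<and> subseq m2 M \<and>
     ascending w m1 \<and> ascending w m2 \<and> word_prod m1 = word_prod m2 \<and> length m1 = length m2 \<longrightarrow> m1 = m2)"

definition exchangeable :: "nat \<Rightarrow> (nat \<times> nat) list \<Rightarrow> (nat \<times> nat) list \<Rightarrow> bool" where
  "exchangeable n M M' \<longleftrightarrow> (\<forall>w m. inj w \<and> subseq m M \<and> ascending w m \<longrightarrow>
     (\<exists>m'. subseq m' M' \<and> flip_equiv n w m m'))"

text \<open>Disjoint alphabets allow each part to be recovered by filtering.\<close>

lemma append3_unique: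
  assumes "A1 @ m1 @ B1 = A2 @ m2 @ B2"
    and "set A1 \<subseteq> P" "set A2 \<subseteq> P" "set m1 \<subseteq> M" "set m2 \<subseteq> M" "set B1 \<subseteq> Q" "set B2 \<subseteq> Q"
    and "P \<inter> M = {}" "P \<inter> Q = {}" "M \<inter> Q = {}"
  shows "A1 = A2 \<and> m1 = m2 \<and> B1 = B2"
proof -
  have F: "filter (\<lambda>x. x \<in> P) (A @ m @ B) = A \<and> filter (\<lambda>x. x \<in> M) (A @ m @ B) = m \<and>
      filter (\<lambda>x. x \<in> Q) (A @ m @ B) = B"
    if "set A \<subseteq> P" "set m \<subseteq> M" "set B \<subseteq> Q" for A m B
  proof -
    have "filter (\<lambda>x. x \<in> X) l = l" if "set l \<subseteq> X" for l X
      using that by (simp add: filter_id_conv subset_iff)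
    moreover have "filter (\<lambda>x. x \<in> X) l = []" if "set l \<subseteq> Y" "X \<inter> Y = {}" for l X Y
      using that by (auto simp: filter_empty_conv)
    moreover have "M \<inter> P = {}" "Q \<inter> P = {}" "Q \<inter> M = {}" using assms(8-10) by auto
    ultimately show ?thesis using that assms(8-10) unfolding filter_append by (metis append_Nil append_Nil2)
  qed
  show ?thesis
    using F[of A1 m1 B1] F[of A2 m2 B2] assms(2-7) unfolding assms(1) by metis
qed

text \<open>A word of \<open>?S\<close> is sent to a word of \<open>?S'\<close> by replacing its
  part from \<open>M\<close>. The outer parts can be read off the result because the three alphabets
  are disjoint, and \<open>unique_words\<close> recovers the part that was replaced.\<close>

lemma card_exchange_le:
  assumes w: "inj w" and fin: "finite G" and closed: "flip_closed n w G"
    and asc: "\<And>g. g \<in> G \<Longrightarrow> ascending w g"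
    and dist: "distinct (P @ M @ Q)" and set: "set M' = set M"
    and uniq: "unique_words M" and exch: "exchangeable n M M'"
  shows "card {g \<in> G. subseq g (P @ M @ Q)} \<le> card {g \<in> G. subseq g (P @ M' @ Q)}"
    (is "card ?S \<le> card ?S'")
proof -
  \<comment> \<open>\<open>R\<close> forgets the flips and records only product and length of the
    middle part, which is what injectivity rests on.\<close>
  define R where "R g g' \<longleftrightarrow> (\<exists>A m m' B. g = A @ m @ B \<and> g' = A @ m' @ B \<and> subseq A P \<and>
    subseq m M \<and> subseq m' M' \<and> subseq B Q \<and> word_prod m' = word_prod m \<and> length m' = length m)" for g g'
  have ex: "\<exists>g'\<in>?S'. R g g'" if "g \<in> ?S" for g
  proof -
    from that obtain A m B where g: "g = A @ m @ B" "subseq A P" "subseq m M" "subseq B Q"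
      by (auto elim!: subseq_appendE)
    have "ascending (w \<circ> word_prod A) m"
      using asc[of g] that g by (simp add: ascending_append)
    moreover have "inj (w \<circ> word_prod A)"
      using w bij_word_prod by (auto intro: inj_compose dest: bij_is_inj)
    ultimately obtain m' where m': "subseq m' M'" "flip_equiv n (w \<circ> word_prod A) m m'"
      using exch g unfolding exchangeable_def by blast
    have "A @ m' @ B \<in> G"
      using flip_closedD[OF flip_equiv_append[OF m'(2)] closed] that g by blast
    moreover have "subseq (A @ m' @ B) (P @ M' @ Q)"
      using g m' by (intro list_emb_append_mono)
    moreover have "R g (A @ m' @ B)"
      unfolding R_def using g m' flip_equiv_invariants[OF m'(2)] by blast
    ultimately show ?thesis by blast
  qed
  have inj: "g1 = g2" if S: "g1 \<in> ?S" "g2 \<in> ?S" and R: "R g1 g'" "R g2 g'" for g1 g2 g'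
  proof -
    obtain A1 m1 m1' B1 where 1: "g1 = A1 @ m1 @ B1" "g' = A1 @ m1' @ B1" "subseq A1 P"
      "subseq m1 M" "subseq m1' M'" "subseq B1 Q" "word_prod m1' = word_prod m1" "length m1' = length m1"
      using R(1) unfolding R_def by blast
    obtain A2 m2 m2' B2 where 2: "g2 = A2 @ m2 @ B2" "g' = A2 @ m2' @ B2" "subseq A2 P"
      "subseq m2 M" "subseq m2' M'" "subseq B2 Q" "word_prod m2' = word_prod m2" "length m2' = length m2"
      using R(2) unfolding R_def by blast
    have sub: "set xs \<subseteq> set ys" if "subseq xs ys" for xs ys :: "(nat \<times> nat) list"
      using that by (auto elim: list_emb_set)
    have "A1 = A2 \<and> m1' = m2' \<and> B1 = B2"
    proof (rule append3_unique)
      show "A1 @ m1' @ B1 = A2 @ m2' @ B2" using 1 2 by metis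
      show "set P \<inter> set M' = {}" "set P \<inter> set Q = {}" "set M' \<inter> set Q = {}"
        using dist set by auto
    qed (use 1(3,5,6) 2(3,5,6) in \<open>simp_all only: sub\<close>)
    moreover have "ascending (w \<circ> word_prod A1) m1" "ascending (w \<circ> word_prod A2) m2"
      using asc[of g1] asc[of g2] S 1(1) 2(1) by (simp_all add: ascending_append)
    ultimately show ?thesis
      using uniq 1 2 unfolding unique_words_def by metis
  qed
  have "\<exists>f. \<forall>g\<in>?S. f g \<in> ?S' \<and> R g (f g)"
    by (rule bchoice) (use ex in blast)
  then obtain f where f: "\<forall>g\<in>?S. f g \<in> ?S' \<and> R g (f g)" ..
  have "inj_on f ?S"
  proof (rule inj_onI)
    fix g1 g2 assume g: "g1 \<in> ?S" "g2 \<in> ?S" "f g1 = f g2"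
    have "R g1 (f g1)" using bspec[OF f g(1)] by (rule conjunct2)
    moreover have "R g2 (f g1)" unfolding g(3) using bspec[OF f g(2)] by (rule conjunct2)
    ultimately show "g1 = g2" by (rule inj[OF g(1,2)])
  qed
  moreover have "f ` ?S \<subseteq> ?S'" using f by blast
  ultimately show ?thesis
    using fin by (intro card_inj_on_le[of f]) auto
qed

lemma unique_words_short:
  assumes "set m1 \<subseteq> transposition_pairs n" "set m2 \<subseteq> transposition_pairs n"
    "word_prod m1 = word_prod m2" "length m1 = length m2" "length m1 \<le> 1"
  shows "m1 = m2"
proof (cases m1)
  case (Cons s l)
  then obtain t where "m1 = [s]" "m2 = [t]" using assms by (cases m2) auto
  then show ?thesis using assms inj_on_tr[of n] by (auto dest: inj_onD simp del: tr_simp)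
qed (use assms in simp)

lemma subseq_pair_iff: "subseq m [x, y] \<longleftrightarrow> m \<in> {[], [x], [y], [x, y]}"
  unfolding in_set_subseqs[symmetric] by auto

lemma subseq_triple_iff:
  "subseq m [x, y, z] \<longleftrightarrow> m \<in> {[], [x], [y], [z], [x, y], [x, z], [y, z], [x, y, z]}"
  unfolding in_set_subseqs[symmetric] by auto

lemma unique_words_pair:
  assumes "s \<in> transposition_pairs n" "t \<in> transposition_pairs n"
  shows "unique_words [s, t]"
  unfolding unique_words_def
proof (intro allI impI, elim conjE)
  fix w m1 m2
  assume m: "subseq m1 [s, t]" "subseq m2 [s, t]" "word_prod m1 = word_prod m2" "length m1 = length m2"
  show "m1 = m2"
  proof (cases "length m1 \<le> 1")
    case True
    show ?thesis
      by (rule unique_words_short[of _ n]) (use True m assms in \<open>auto simp: subseq_pair_iff simp del: word_prod.simps\<close>)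
  next
    case False
    then show ?thesis using m by (auto simp: subseq_pair_iff)
  qed
qed

text \<open>The words \<open>[x, y]\<close> and \<open>[y, z]\<close> may share their product, and
  in a braid segment they do; the last assumption prevents them from ascending from the same
  start.\<close>

lemma unique_words_triple:
  assumes "x \<in> transposition_pairs n" "y \<in> transposition_pairs n" "z \<in> transposition_pairs n"
    and "word_prod [x, z] \<noteq> word_prod [x, y]" "word_prod [x, z] \<noteq> word_prod [y, z]"
    and "\<And>w. \<not> (ascending w [x, y] \<and> ascending w [y, z])"
  shows "unique_words [x, y, z]"
  unfolding unique_words_def
proof (intro allI impI, elim conjE)
  fix w m1 m2
  assume m: "subseq m1 [x, y, z]" "subseq m2 [x, y, z]" "word_prod m1 = word_prod m2"
    "length m1 = length m2" "ascending w m1" "ascending w m2"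
  show "m1 = m2"
  proof (cases "length m1 \<le> 1")
    case True
    show ?thesis
      by (rule unique_words_short[of _ n]) (use True m assms in \<open>auto simp: subseq_triple_iff simp del: word_prod.simps\<close>)
  next
    case False
    then have "m1 \<in> {[x, y], [x, z], [y, z], [x, y, z]}" "m2 \<in> {[x, y], [x, z], [y, z], [x, y, z]}"
      using m by (auto simp: subseq_triple_iff simp del: word_prod.simps ascending.simps)
    then show ?thesis
      using m(3-6) assms(4-6) by (auto simp del: word_prod.simps ascending.simps)
  qed
qed

lemma exchangeable_pair:
  assumes s: "s \<in> transposition_pairs n" and t: "t \<in> transposition_pairs n"
    and disj: "{fst s, snd s} \<inter> {fst t, snd t} = {}"
  shows "exchangeable n [s, t] [t, s]"
  unfolding exchangeable_def
proof (intro allI impI, elim conjE)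
  fix w m assume m: "subseq m [s, t]" "ascending w m"
  show "\<exists>m'. subseq m' [t, s] \<and> flip_equiv n w m m'"
  proof (cases "m = [s, t]")
    case True
    have "ascending w [t, s]"
      using m disj unfolding True by (cases s; cases t) (auto simp: transpose_def split: if_splits)
    then have "flip_equiv n w [s, t] [t, s]"
      using flip_equiv_flip[of t n s s t w "[]" "[]"] s t disjoint_flip[OF s t disj t s]
      by (simp del: word_prod.simps(2) ascending.simps)
    then show ?thesis using True by blast
  next
    case False
    then have "subseq m [t, s]" using m by (auto simp: subseq_pair_iff)
    then show ?thesis using flip_equiv.refl by blast
  qed
qed


text \<open>Subwords of at most one letter survive the reversal. Both \<open>[x, y]\<close> and
  \<open>[y, z]\<close> become \<open>[z, x]\<close>, the third factorization of their 3-cycle;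
  \<open>[x, z]\<close> becomes \<open>[z, y]\<close> or \<open>[y, x]\<close>, whichever
  ascends.\<close>

lemma exchangeable_triple:
  assumes pairs: "x \<in> transposition_pairs n" "y \<in> transposition_pairs n" "z \<in> transposition_pairs n"
    and prod: "word_prod [z, x] = word_prod [x, y]" "word_prod [y, z] = word_prod [x, y]"
      "word_prod [z, y] = word_prod [x, z]" "word_prod [y, x] = word_prod [x, z]"
    and asc: "\<And>w. ascending w [x, y] \<Longrightarrow> ascending w [z, x]"
      "\<And>w. ascending w [y, z] \<Longrightarrow> ascending w [z, x]"
      "\<And>w. inj w \<Longrightarrow> ascending w [x, z] \<Longrightarrow> ascending w [z, y] \<or> ascending w [y, x]"
      "\<And>w. ascending w [x, y, z] \<Longrightarrow> ascending (w \<circ> tr z) [y, x]"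
  shows "exchangeable n [x, y, z] [z, y, x]"
  unfolding exchangeable_def
proof (intro allI impI, elim conjE)
  fix w :: "nat \<Rightarrow> nat" and m assume w: "inj w" and m: "subseq m [x, y, z]" "ascending w m"
  have flip2: "flip_equiv n w [s, t] [s', t']"
    if "s' \<in> transposition_pairs n" "t' \<in> transposition_pairs n" "ascending w [s', t']"
      "word_prod [s', t'] = word_prod [s, t]" for s t s' t'
    using flip_equiv_flip[of s' n t' s t w "[]" "[]"] that by (simp del: word_prod.simps(2) ascending.simps)
  consider "subseq m [z, y, x]" | "m = [x, y]" | "m = [y, z]" | "m = [x, z]" | "m = [x, y, z]"
    using m(1) unfolding subseq_triple_iff by blast
  then show "\<exists>m'. subseq m' [z, y, x] \<and> flip_equiv n w m m'"
  proof cases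
    case 1
    then show ?thesis using flip_equiv.refl by blast
  next
    case 2
    then have "flip_equiv n w m [z, x]" using flip2 pairs prod asc(1) m by metis
    then show ?thesis by (intro exI[of _ "[z, x]"]) simp
  next
    case 3
    then have "flip_equiv n w m [z, x]" using flip2 pairs prod asc(2) m by metis
    then show ?thesis by (intro exI[of _ "[z, x]"]) simp
  next
    case 4
    then have "flip_equiv n w m [z, y] \<or> flip_equiv n w m [y, x]" using flip2 pairs prod asc(3) m w by metis
    then show ?thesis using subseq_triple_iff[of _ z y x] by blast
  next
    case 5
    \<comment> \<open>The braid relation as two flips: \<open>[x, y, z]\<close> becomes
      \<open>[z, x, z]\<close>, then \<open>[z, y, x]\<close>.\<close>
    have "ascending w [x, y]" using m 5 by simp
    then have zx: "ascending w [z, x]" by (rule asc)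
    have "flip_equiv n w ([] @ [x, y] @ [z]) ([] @ [z, x] @ [z])"
      by (rule flip_equiv_flip) (use pairs prod zx in \<open>simp_all del: ascending.simps word_prod.simps(2)\<close>)
    then have "flip_equiv n w m ([z] @ [x, z] @ [])" using 5 by simp
    from flip_equiv.step[OF this pairs(2,1) prod(4)]
    have "flip_equiv n w m [z, y, x]" using asc(4)[of w] m 5 by simp
    then show ?thesis by blast
  qed
qed

lemma braid_words:
  assumes abc: "1 \<le> a" "a < b" "b < c" "c \<le> n"
  shows "unique_words [(a, b), (a, c), (b, c)]" "unique_words [(b, c), (a, c), (a, b)]"
    and "exchangeable n [(a, b), (a, c), (b, c)] [(b, c), (a, c), (a, b)]"
    and "exchangeable n [(b, c), (a, c), (a, b)] [(a, b), (a, c), (b, c)]"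
proof -
  have pairs: "(a, b) \<in> transposition_pairs n" "(a, c) \<in> transposition_pairs n" "(b, c) \<in> transposition_pairs n"
    using abc by (auto simp: transposition_pairs_def)
  note prod = word_prod_triple[OF abc(2,3)]
  note asc = ascending_triple[OF abc(2,3)]
  show "unique_words [(a, b), (a, c), (b, c)]"
    by (rule unique_words_triple[OF pairs]) (use prod in \<open>auto simp: asc simp del: word_prod.simps ascending.simps\<close>)
  show "unique_words [(b, c), (a, c), (a, b)]"
    by (rule unique_words_triple[OF pairs(3,2,1)]) (use prod in \<open>auto simp: asc simp del: word_prod.simps ascending.simps\<close>)
  have asc3: "ascending w [s, t, q] \<longleftrightarrow> ascending w [s, t] \<and> ascending (w \<circ> tr s \<circ> tr t) [q]" for w s t q
    by simp
  have ineq: "w a \<noteq> w b \<and> w a \<noteq> w c \<and> w b \<noteq> w c" if "inj w" for w :: "nat \<Rightarrow> nat"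
    using abc by (auto simp: inj_eq[OF that])
  show "exchangeable n [(a, b), (a, c), (b, c)] [(b, c), (a, c), (a, b)]"
  proof (rule exchangeable_triple[OF pairs])
    fix w :: "nat \<Rightarrow> nat"
    show "ascending w [(b, c), (a, c)] \<or> ascending w [(a, c), (a, b)]"
      if "inj w" "ascending w [(a, b), (b, c)]"
      using that(2) ineq[OF that(1)] unfolding asc by linarith
    show "ascending (w \<circ> tr (b, c)) [(a, c), (a, b)]" if "ascending w [(a, b), (a, c), (b, c)]"
      using that abc unfolding asc asc3 by (simp add: transpose_def)
  qed (simp_all only: prod, (unfold asc, auto)+)
  show "exchangeable n [(b, c), (a, c), (a, b)] [(a, b), (a, c), (b, c)]"
  proof (rule exchangeable_triple[OF pairs(3,2,1)])
    fix w :: "nat \<Rightarrow> nat"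
    show "ascending w [(a, b), (a, c)] \<or> ascending w [(a, c), (b, c)]"
      if "inj w" "ascending w [(b, c), (a, b)]"
      using that(2) ineq[OF that(1)] unfolding asc by linarith
    show "ascending (w \<circ> tr (a, b)) [(a, c), (b, c)]" if "ascending w [(b, c), (a, c), (a, b)]"
      using that abc unfolding asc asc3 by (simp add: transpose_def)
  qed (simp_all only: prod, (unfold asc, auto)+)
qed

section \<open>Braid moves between reflection orderings\<close>

text \<open>The braid rule runs in one direction, towards \<open>(a, b), (a, c), (b, c)\<close>, the
  order in which the normal form \<open>lex_list\<close> has every triple.\<close>

inductive braid_move :: "(nat \<times> nat) list \<Rightarrow> (nat \<times> nat) list \<Rightarrow> bool" where
  commute: "{fst s, snd s} \<inter> {fst t, snd t} = {} \<Longrightarrow> braid_move (P @ [s, t] @ Q) (P @ [t, s] @ Q)"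
| braid: "a < b \<Longrightarrow> b < c \<Longrightarrow>
    braid_move (P @ [(b, c), (a, c), (a, b)] @ Q) (P @ [(a, b), (a, c), (b, c)] @ Q)"

definition reflection_list :: "nat \<Rightarrow> (nat \<times> nat) list \<Rightarrow> bool" where
  "reflection_list n L \<longleftrightarrow> distinct L \<and> set L = transposition_pairs n \<and>
     (\<forall>a b c. 1 \<le> a \<and> a < b \<and> b < c \<and> c \<le> n \<longrightarrow>
        filter (\<lambda>t. t \<in> {(a, b), (a, c), (b, c)}) L \<in>
          {[(a, b), (a, c), (b, c)], [(b, c), (a, c), (a, b)]})"

lemma braid_move_append: "braid_move L L' \<Longrightarrow> braid_move (L @ R) (L' @ R)"
proof (induction rule: braid_move.induct)
  case (commute s t P Q)
  then show ?case using braid_move.commute[of s t P "Q @ R"] by simp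
next
  case (braid a b c P Q)
  then show ?case using braid_move.braid[of a b c P "Q @ R"] by simp
qed

lemma braid_moves_append: "braid_move\<^sup>*\<^sup>* L L' \<Longrightarrow> braid_move\<^sup>*\<^sup>* (L @ R) (L' @ R)"
  by (induction rule: rtranclp_induct) (auto intro: rtranclp.rtrancl_into_rtrancl braid_move_append)

text \<open>Disjoint pairs never lie in a common triple, and two different triples share at most one
  pair. So a move is invisible to the filter of every triple except, for a braid, its own, which it
  reverses.\<close>

lemma reflection_list_braid_move:
  assumes "braid_move L L'" "reflection_list n L"
  shows "reflection_list n L'"
  using assms
proof (induction rule: braid_move.induct)
  case (commute s t P Q)
  have "filter (\<lambda>t. t \<in> {(a, b), (a, c), (b, c)}) [t, s] = filter (\<lambda>t. t \<in> {(a, b), (a, c), (b, c)}) [s, t]"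
    for a b c using commute(1) by auto
  then show ?case
    using commute(2) unfolding reflection_list_def filter_append by (auto simp del: filter.simps)
next
  case (braid x y z P Q)
  let ?F = "\<lambda>a b c. filter (\<lambda>t. t \<in> {(a, b), (a, c), (b, c)})"
  let ?M = "[(y, z), (x, z), (x, y)]" and ?M' = "[(x, y), (x, z), (y, z)]"
  have dist: "distinct (P @ ?M @ Q)" using braid by (simp add: reflection_list_def)
  have "?F a b c (P @ ?M' @ Q) \<in> {[(a, b), (a, c), (b, c)], [(b, c), (a, c), (a, b)]}"
    if abc: "1 \<le> a" "a < b" "b < c" "c \<le> n" for a b c
  proof (cases "(a, b, c) = (x, y, z)")
    case True
    have "?F a b c P = []" "?F a b c Q = []" using dist True by (auto simp: filter_empty_conv)
    then show ?thesis using True unfolding filter_append by simp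
  next
    case False
    then have "?F a b c ?M' = ?F a b c ?M" using abc braid by auto
    then show ?thesis using braid abc unfolding filter_append reflection_list_def by metis
  qed
  then show ?case using braid dist unfolding reflection_list_def by auto
qed

lemma reflection_list_braid_moves:
  "braid_move\<^sup>*\<^sup>* L L' \<Longrightarrow> reflection_list n L \<Longrightarrow> reflection_list n L'"
  by (induction rule: rtranclp_induct) (auto intro: reflection_list_braid_move)

text \<open>Equality comes from \<open>card_exchange_le\<close> used twice, with the segment and its
  reverse in exchanged roles.\<close>

lemma card_subseq_braid_move:
  assumes "braid_move L L'" "reflection_list n L"
    and w: "inj w" and fin: "finite G" and closed: "flip_closed n w G"
    and asc: "\<And>g. g \<in> G \<Longrightarrow> ascending w g"
  shows "card {g \<in> G. subseq g L} = card {g \<in> G. subseq g L'}"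
  using assms(1,2)
proof (induction rule: braid_move.induct)
  case (commute s t P Q)
  have st: "s \<in> transposition_pairs n" "t \<in> transposition_pairs n"
    using commute by (auto simp: reflection_list_def)
  have dist: "distinct (P @ [s, t] @ Q)" "distinct (P @ [t, s] @ Q)"
    using commute by (auto simp: reflection_list_def)
  have disj': "{fst t, snd t} \<inter> {fst s, snd s} = {}" using commute by blast
  show ?case
    using card_exchange_le[OF w fin closed asc dist(1) _ unique_words_pair[OF st] exchangeable_pair[OF st commute(1)]]
      card_exchange_le[OF w fin closed asc dist(2) _ unique_words_pair[OF st(2,1)] exchangeable_pair[OF st(2,1) disj']]
    by (simp add: insert_commute)
next
  case (braid a b c P Q)
  let ?M = "[(b, c), (a, c), (a, b)]" and ?M' = "[(a, b), (a, c), (b, c)]"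
  have "set ?M \<subseteq> transposition_pairs n" using braid unfolding reflection_list_def set_append by blast
  then have abc: "1 \<le> a" "a < b" "b < c" "c \<le> n" by (auto simp: transposition_pairs_def)
  have dist: "distinct (P @ ?M @ Q)" "distinct (P @ ?M' @ Q)"
    using braid by (auto simp: reflection_list_def)
  have set: "set ?M' = set ?M" by auto
  show ?case
    using card_exchange_le[OF w fin closed asc dist(1) set braid_words(2,4)[OF abc]]
      card_exchange_le[OF w fin closed asc dist(2) set[symmetric] braid_words(1,3)[OF abc]]
    by simp
qed

lemma card_subseq_braid_moves:
  assumes "braid_move\<^sup>*\<^sup>* L L'" "reflection_list n L"
    and "inj w" "finite G" "flip_closed n w G" "\<And>g. g \<in> G \<Longrightarrow> ascending w g"
  shows "card {g \<in> G. subseq g L} = card {g \<in> G. subseq g L'}"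
  using assms(1)
proof (induction rule: rtranclp_induct)
  case (step M M')
  then show ?case
    using card_subseq_braid_move[OF step(2) reflection_list_braid_moves[OF step(1) assms(2)] assms(3-6)] by simp
qed simp

section \<open>Positions in a reflection list\<close>

definition pos :: "'a list \<Rightarrow> 'a \<Rightarrow> nat" where
  "pos L x = length (takeWhile (\<lambda>y. y \<noteq> x) L)"

lemma pos_append: "pos (A @ B) x = (if x \<in> set A then pos A x else length A + pos B x)"
  by (induction A) (auto simp: pos_def)

lemma pos_less_length: "x \<in> set L \<Longrightarrow> pos L x < length L"
  by (induction L) (auto simp: pos_def)

lemma pos_middle: "L = X @ x # R \<Longrightarrow> distinct L \<Longrightarrow> pos L x = length X"
  by (simp add: pos_append pos_def[of "_ # _"])

lemma pos_less_filter:
  assumes "filter Q L = X @ x # R" "y \<in> set R" "distinct L"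
  shows "pos L x < pos L y"
  using assms
proof (induction L arbitrary: X)
  case (Cons z L)
  have dist: "distinct (X @ x # R)" using Cons.prems(1,3) by (metis distinct_filter)
  have "x \<in> set (filter Q (z # L))" "y \<in> set (filter Q (z # L))"
    unfolding Cons.prems(1) using Cons.prems(2) by auto
  then have xy: "Q x" "Q y" "x \<noteq> y"
    using Cons.prems(2) dist by (auto simp only: set_filter distinct_append distinct.simps)
  show ?case
  proof (cases "Q z \<and> X = []")
    case True
    then have "x = z" using Cons.prems by simp
    then show ?thesis using xy by (simp add: pos_def)
  next
    case False
    then obtain X' where X': "filter Q L = X' @ x # R" and "Q z \<Longrightarrow> z \<in> set X"
      using Cons.prems by (cases X) (auto split: if_splits)
    then have "z \<noteq> x" "z \<noteq> y" using Cons.prems(2) xy dist by auto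
    then show ?thesis using Cons.IH[OF X'] Cons.prems by (simp add: pos_def)
  qed
qed simp

text \<open>As inequalities between positions, the triple conditions can be combined by arithmetic
  to refute an impossible placement.\<close>

lemma reflection_list_pos:
  assumes L: "reflection_list n L" and abc: "1 \<le> a" "a < b" "b < c" "c \<le> n"
  shows "pos L (a, b) < pos L (a, c) \<and> pos L (a, c) < pos L (b, c) \<or>
    pos L (b, c) < pos L (a, c) \<and> pos L (a, c) < pos L (a, b)"
proof -
  let ?F = "filter (\<lambda>t. t \<in> {(a, b), (a, c), (b, c)}) L"
  have dist: "distinct L" using L by (simp add: reflection_list_def)
  have order: "pos L x < pos L y \<and> pos L y < pos L z" if "?F = [x, y, z]" for x y z
    using pos_less_filter[OF _ _ dist, of _ "[]" x "[y, z]" y] pos_less_filter[OF _ _ dist, of _ "[x]" y "[z]" z] that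
    by simp
  have "?F = [(a, b), (a, c), (b, c)] \<or> ?F = [(b, c), (a, c), (a, b)]"
    using L abc unfolding reflection_list_def by blast
  then show ?thesis using order by blast
qed

section \<open>Moving the pairs \<open>(a, n)\<close> to the end\<close>

lemma braid_moves_commute:
  assumes "\<And>s. s \<in> set B \<Longrightarrow> {fst s, snd s} \<inter> {fst t, snd t} = {}"
  shows "braid_move\<^sup>*\<^sup>* (P @ B @ [t] @ Q) (P @ [t] @ B @ Q)"
  using assms
proof (induction B arbitrary: P)
  case (Cons s B)
  have "braid_move\<^sup>*\<^sup>* ((P @ [s]) @ B @ [t] @ Q) ((P @ [s]) @ [t] @ B @ Q)"
    by (rule Cons.IH) (use Cons.prems in auto)
  moreover have "braid_move (P @ [s, t] @ (B @ Q)) (P @ [t, s] @ (B @ Q))"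
    by (rule braid_move.commute) (use Cons.prems in auto)
  ultimately show ?case by simp
qed simp

text \<open>A pair \<open>(c,d)\<close> that directly follows a block of pairs \<open>(a,n)\<close> commutes with the
  whole block unless \<open>(d,n)\<close> and \<open>(c,n)\<close> both occur in it, in this order. They are then
  adjacent: an entry \<open>(e,n)\<close> between them would contradict the conditions on the triples
  within \<open>{c,d,e,n}\<close>.\<close>

lemma braid_moves_extract:
  assumes L: "reflection_list n (A @ B @ [(c, d)] @ C)"
    and A: "\<And>t. t \<in> set A \<Longrightarrow> snd t \<noteq> n" and B: "\<And>t. t \<in> set B \<Longrightarrow> snd t = n" and d: "d \<noteq> n"
  shows "\<exists>B'. braid_move\<^sup>*\<^sup>* (A @ B @ [(c, d)] @ C) (A @ [(c, d)] @ B' @ C) \<and> (\<forall>t\<in>set B'. snd t = n)"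
proof -
  let ?L = "A @ B @ [(c, d)] @ C"
  have dist: "distinct ?L" and set: "set ?L = transposition_pairs n"
    using L by (auto simp: reflection_list_def)
  have "(c, d) \<in> transposition_pairs n" using set by auto
  then have cd: "1 \<le> c" "c < d" "d < n" using d by (auto simp: transposition_pairs_def)
  have posA: "pos ?L t < length A" if "t \<in> set A" for t
    using that pos_less_length[OF that] by (simp add: pos_append)
  have posB: "length A \<le> pos ?L t \<and> pos ?L t < length A + length B" if "t \<in> set B" for t
    using that dist pos_less_length[OF that] by (auto simp: pos_append)
  have poscd: "pos ?L (c, d) = length A + length B"
    using dist by (simp add: pos_append pos_def[of "_ # _"])
  have posC: "length A + length B < pos ?L t" if "t \<in> set C" for t
    using that dist by (auto simp: pos_append pos_def[of "_ # _"])
  \<comment> \<open>A pair with larger entry below \<open>n\<close> cannot lie in the block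
    \<open>B\<close>, so an inequality against a member of \<open>B\<close> already decides on which
    side of the block it stands.\<close>
  have posn: "pos ?L (e, f) < length A \<or> length A + length B < pos ?L (e, f) \<or> (e, f) = (c, d)"
    if "1 \<le> e" "e < f" "f < n" for e f
  proof -
    have "(e, f) \<in> set ?L" using that unfolding set by (auto simp: transposition_pairs_def)
    then show ?thesis using posA posC B that by fastforce
  qed
  have inB: "(e, n) \<in> set B \<longleftrightarrow> pos ?L (e, n) < length A + length B" if "1 \<le> e" "e < n" for e
  proof -
    have "(e, n) \<in> set ?L" using that unfolding set by (auto simp: transposition_pairs_def)
    then show ?thesis using posB posC[of "(e, n)"] A[of "(e, n)"] d by auto
  qed
  note order = reflection_list_pos[OF L]
  \<comment> \<open>\<open>(c, n)\<close> lies between \<open>(c, d)\<close> and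
    \<open>(d, n)\<close>, so both pairs ending in \<open>n\<close> are on the same side of
    \<open>(c, d)\<close>. The left side means inside \<open>B\<close>, since \<open>A\<close> has
    no such pairs.\<close>
  from order[of c d n] cd consider
      "length A + length B < pos ?L (c, n)" "length A + length B < pos ?L (d, n)"
    | "pos ?L (d, n) < pos ?L (c, n)" "pos ?L (c, n) < length A + length B"
    unfolding poscd by linarith
  then show ?thesis
  proof cases
    case 1
    have "{fst s, snd s} \<inter> {fst (c, d), snd (c, d)} = {}" if "s \<in> set B" for s
      using that 1 inB[of c] inB[of d] cd B[OF that] by (cases s) auto
    then show ?thesis using braid_moves_commute[of B "(c, d)" A C] B by blast
  next
    case 2
    then have "(d, n) \<in> set B" "(c, n) \<in> set B" using inB[of c] inB[of d] cd by auto
    then obtain B1 R where R: "B = B1 @ (d, n) # R" by (meson split_list)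
    have "(c, n) \<in> set R"
    proof (rule ccontr)
      assume "(c, n) \<notin> set R"
      then have "(c, n) \<in> set B1" using \<open>(c, n) \<in> set B\<close> R cd by auto
      then obtain X Y where XY: "B1 = X @ (c, n) # Y" by (meson split_list)
      have "pos ?L (c, n) = length (A @ X)"
        by (rule pos_middle[OF _ dist]) (simp add: R XY)
      moreover have "pos ?L (d, n) = length (A @ B1)"
        by (rule pos_middle[OF _ dist]) (simp add: R)
      ultimately have "pos ?L (c, n) < pos ?L (d, n)" by (simp add: XY)
      then show False using 2 by simp
    qed
    then obtain B2 B3 where B_eq: "B = B1 @ [(d, n)] @ B2 @ [(c, n)] @ B3"
      using R by (metis append_Cons append_Nil split_list)
    have "B2 = []"
    proof (rule ccontr)
      assume "B2 \<noteq> []"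
      then obtain e where e: "(e, n) \<in> set B2"
        using B B_eq by (cases B2) (auto, metis prod.collapse)
      then have "(e, n) \<in> transposition_pairs n" using B_eq set by auto
      then have en: "1 \<le> e" "e < n" by (auto simp: transposition_pairs_def)
      have ne: "e \<noteq> c" "e \<noteq> d" using e dist B_eq by auto
      obtain X Y where XY: "B2 = X @ (e, n) # Y" using e by (meson split_list)
      have "pos ?L (d, n) = length (A @ B1)"
        by (rule pos_middle[OF _ dist]) (simp add: B_eq)
      moreover have "pos ?L (e, n) = length (A @ B1 @ [(d, n)] @ X)"
        by (rule pos_middle[OF _ dist]) (simp add: B_eq XY)
      moreover have "pos ?L (c, n) = length (A @ B1 @ [(d, n)] @ B2)"
        by (rule pos_middle[OF _ dist]) (simp add: B_eq)
      ultimately have pos: "pos ?L (d, n) < pos ?L (e, n)" "pos ?L (e, n) < pos ?L (c, n)" "length A \<le> pos ?L (d, n)"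
        by (simp_all add: XY)
      \<comment> \<open>Wherever \<open>e\<close> lies, the triples formed with \<open>n\<close>
        decide on which side of the block the pair of \<open>c, e\<close> and the pair of
        \<open>d, e\<close> stand. The middle pair of the triple on \<open>c, d, e\<close> then
        fails to lie between the other two.\<close>
      consider "e < c" | "c < e" "e < d" | "d < e" using ne by linarith
      then show False
      proof cases
        case 1
        show False
          using order[of e c n] order[of e d n] order[of e c d] posn[of e c] posn[of e d] pos 2 1 cd en ne poscd
          by auto
      next
        case 2: 2
        show False
          using order[of c e n] order[of e d n] order[of c e d] posn[of c e] posn[of e d] pos
            \<open>pos ?L (c, n) < length A + length B\<close> 2 cd en ne poscd by auto
      next
        case 3
        show False
          using order[of c e n] order[of d e n] order[of c d e] posn[of c e] posn[of d e] pos 2 3 cd en ne poscd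
          by auto
      qed
    qed
    then have B_eq: "B = B1 @ [(d, n), (c, n)] @ B3" using B_eq by simp
    have comm: "{fst s, snd s} \<inter> {fst (c, d), snd (c, d)} = {}" if "s \<in> set B1 \<union> set B3" for s
    proof -
      have "snd s = n" "s \<noteq> (c, n)" "s \<noteq> (d, n)" using that B[of s] dist B_eq by auto
      then show ?thesis using cd by (cases s) auto
    qed
    \<comment> \<open>\<open>(c, d)\<close> travels to the left: past \<open>B3\<close> by
      commutations, past \<open>(d, n), (c, n)\<close> by a braid move that reverses the three, and
      past \<open>B1\<close> by commutations.\<close>
    have "braid_move\<^sup>*\<^sup>* ((A @ B1 @ [(d, n), (c, n)]) @ B3 @ [(c, d)] @ C)
       ((A @ B1 @ [(d, n), (c, n)]) @ [(c, d)] @ B3 @ C)"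
      by (rule braid_moves_commute) (use comm in blast)
    moreover have "braid_move ((A @ B1) @ [(d, n), (c, n), (c, d)] @ (B3 @ C))
       ((A @ B1) @ [(c, d), (c, n), (d, n)] @ (B3 @ C))"
      by (rule braid_move.braid) (use cd in auto)
    moreover have "braid_move\<^sup>*\<^sup>* (A @ B1 @ [(c, d)] @ ([(c, n), (d, n)] @ B3 @ C))
       (A @ [(c, d)] @ B1 @ ([(c, n), (d, n)] @ B3 @ C))"
      by (rule braid_moves_commute) (use comm in blast)
    ultimately have "braid_move\<^sup>*\<^sup>* ?L (A @ [(c, d)] @ (B1 @ [(c, n), (d, n)] @ B3) @ C)"
      unfolding B_eq by simp
    moreover have "\<forall>t\<in>set (B1 @ [(c, n), (d, n)] @ B3). snd t = n" using B B_eq by auto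
    ultimately show ?thesis by blast
  qed
qed

text \<open>The list is scanned from the left, with \<open>B\<close> the block of pairs ending in
  \<open>n\<close> met so far and \<open>C\<close> the unread rest. The next pair either joins
  \<open>B\<close> or is brought in front of the block by
  \<open>braid_moves_extract\<close>.\<close>

lemma braid_moves_separate:
  assumes "reflection_list n (A @ B @ C)"
    and "\<And>t. t \<in> set A \<Longrightarrow> snd t \<noteq> n" and "\<And>t. t \<in> set B \<Longrightarrow> snd t = n"
  shows "\<exists>A' B'. braid_move\<^sup>*\<^sup>* (A @ B @ C) (A' @ B') \<and> (\<forall>t\<in>set A'. snd t \<noteq> n) \<and> (\<forall>t\<in>set B'. snd t = n)"
  using assms
proof (induction C arbitrary: A B)
  case Nil
  then show ?case by (intro exI[of _ A] exI[of _ B]) simp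
next
  case (Cons t C)
  show ?case
  proof (cases "snd t = n")
    case True
    have "\<exists>A' B'. braid_move\<^sup>*\<^sup>* (A @ (B @ [t]) @ C) (A' @ B') \<and> (\<forall>t\<in>set A'. snd t \<noteq> n) \<and> (\<forall>t\<in>set B'. snd t = n)"
      by (rule Cons.IH) (use Cons.prems True in auto)
    then show ?thesis by simp
  next
    case False
    obtain c d where t: "t = (c, d)" by (metis surj_pair)
    obtain B' where B': "braid_move\<^sup>*\<^sup>* (A @ B @ [t] @ C) (A @ [t] @ B' @ C)" "\<forall>t\<in>set B'. snd t = n"
      using braid_moves_extract[of n A B c d C] Cons.prems False by (auto simp: t)
    have "\<exists>A' B''. braid_move\<^sup>*\<^sup>* ((A @ [t]) @ B' @ C) (A' @ B'') \<and> (\<forall>t\<in>set A'. snd t \<noteq> n) \<and> (\<forall>t\<in>set B''. snd t = n)"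
      by (rule Cons.IH)
        (use reflection_list_braid_moves[OF B'(1), of n] Cons.prems B'(2) False in auto)
    moreover have "braid_move\<^sup>*\<^sup>* (A @ B @ t # C) ((A @ [t]) @ B' @ C)" using B'(1) by simp
    ultimately show ?thesis by (meson rtranclp_trans)
  qed
qed

section \<open>The normal form of a reflection list\<close>

fun lex_list :: "nat \<Rightarrow> (nat \<times> nat) list" where
  "lex_list 0 = []"
| "lex_list (Suc m) = lex_list m @ map (\<lambda>a. (a, Suc m)) [1..<Suc m]"

lemma pos_nth: "distinct L \<Longrightarrow> i < length L \<Longrightarrow> pos L (L ! i) = i"
proof (induction L arbitrary: i)
  case (Cons x L)
  then show ?case by (cases i) (auto simp: pos_def)
qed simp

lemma braid_moves_lex_list:
  "reflection_list n L \<Longrightarrow> braid_move\<^sup>*\<^sup>* L (lex_list n)"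
proof (induction n arbitrary: L)
  case 0
  moreover have "transposition_pairs 0 = {}" by (auto simp: transposition_pairs_def)
  ultimately have "L = []" by (simp add: reflection_list_def)
  then show ?case by simp
next
  case (Suc m)
  obtain A B where AB: "braid_move\<^sup>*\<^sup>* L (A @ B)"
    and A: "\<And>t. t \<in> set A \<Longrightarrow> snd t \<noteq> Suc m" and B: "\<And>t. t \<in> set B \<Longrightarrow> snd t = Suc m"
    using braid_moves_separate[of "Suc m" "[]" "[]" L] Suc.prems by auto
  have R: "reflection_list (Suc m) (A @ B)"
    using reflection_list_braid_moves[OF AB Suc.prems] .
  have dist: "distinct (A @ B)" and set: "set A \<union> set B = transposition_pairs (Suc m)"
    using R by (auto simp: reflection_list_def)
  have setA: "set A = transposition_pairs m"
  proof -
    have "set A = {t \<in> set A \<union> set B. snd t \<noteq> Suc m}" using A B by auto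
    also have "\<dots> = transposition_pairs m" unfolding set by (auto simp: transposition_pairs_def)
    finally show ?thesis .
  qed
  have setB: "set B = (\<lambda>a. (a, Suc m)) ` {1..<Suc m}"
  proof -
    have "set B = {t \<in> set A \<union> set B. snd t = Suc m}" using A B by auto
    also have "\<dots> = (\<lambda>a. (a, Suc m)) ` {1..<Suc m}"
      unfolding set by (force simp: transposition_pairs_def)
    finally show ?thesis .
  qed
  have "reflection_list m A"
    unfolding reflection_list_def
  proof (intro conjI allI impI)
    fix a b c assume abc: "1 \<le> a \<and> a < b \<and> b < c \<and> c \<le> m"
    have "filter (\<lambda>t. t \<in> {(a, b), (a, c), (b, c)}) B = []"
      using B abc by (fastforce simp: filter_empty_conv)
    then have "filter (\<lambda>t. t \<in> {(a, b), (a, c), (b, c)}) A = filter (\<lambda>t. t \<in> {(a, b), (a, c), (b, c)}) (A @ B)"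
      by simp
    also have "\<dots> \<in> {[(a, b), (a, c), (b, c)], [(b, c), (a, c), (a, b)]}"
      using R abc unfolding reflection_list_def by (meson le_SucI)
    finally show "filter (\<lambda>t. t \<in> {(a, b), (a, c), (b, c)}) A
      \<in> {[(a, b), (a, c), (b, c)], [(b, c), (a, c), (a, b)]}" .
  qed (use dist setA in auto)
  then have "braid_move\<^sup>*\<^sup>* (A @ B) (lex_list m @ B)"
    using braid_moves_append Suc.IH by blast
  moreover have "B = map (\<lambda>a. (a, Suc m)) [1..<Suc m]"
  proof -
    have "sorted_wrt (<) (map fst B)"
      unfolding sorted_wrt_iff_nth_less
    proof (intro allI impI)
      fix i j assume ij: "i < j" "j < length (map fst B)"
      obtain x y where xy: "B ! i = (x, Suc m)" "B ! j = (y, Suc m)"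
        using ij B by (metis length_map nth_mem order.strict_trans prod.collapse)
      have mem: "(x, Suc m) \<in> set B" "(y, Suc m) \<in> set B"
        using ij xy by (metis length_map nth_mem order.strict_trans)+
      have posB: "pos (A @ B) (x, Suc m) = length A + i" "pos (A @ B) (y, Suc m) = length A + j"
        using dist ij mem pos_nth[of B i] pos_nth[of B j] xy by (auto simp: pos_append)
      have "x \<noteq> y" using posB ij by auto
      \<comment> \<open>If \<open>y < x\<close>, then \<open>(y, x)\<close> stands in
        \<open>A\<close>, ahead of the whole block; the triple \<open>y, x, Suc m\<close> then puts
        \<open>(y, Suc m)\<close> before \<open>(x, Suc m)\<close>, against
        \<open>i < j\<close>.\<close>
      have "\<not> y < x"
      proof
        assume "y < x"
        moreover have "1 \<le> y" "x < Suc m" using mem setB by auto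
        moreover from calculation have "pos (A @ B) (y, x) < length A"
          using setA pos_less_length[of "(y, x)" A] by (auto simp: pos_append transposition_pairs_def)
        ultimately show False
          using reflection_list_pos[OF R, of y x "Suc m"] posB ij by auto
      qed
      then show "map fst B ! i < map fst B ! j" using \<open>x \<noteq> y\<close> xy ij by simp
    qed
    moreover have "set (map fst B) = set [1..<Suc m]" using setB by (simp add: image_image del: upt_Suc)
    ultimately have "map fst B = [1..<Suc m]"
      by (intro strict_sorted_equal) (simp_all only: sorted_wrt_upt)
    moreover have "B = map (\<lambda>a. (a, Suc m)) (map fst B)"
      using B by (simp add: map_idI prod_eq_iff)
    ultimately show ?thesis by metis
  qed
  ultimately show ?case using AB by auto
qed

section \<open>Paths and words\<close>

fun path_of :: "(nat \<Rightarrow> nat) \<Rightarrow> (nat \<times> nat) list \<Rightarrow> (nat \<Rightarrow> nat) list" where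
  "path_of u [] = [u]"
| "path_of u (t # g) = u # path_of (tr t \<circ> u) g"

definition words :: "nat \<Rightarrow> nat \<Rightarrow> (nat \<Rightarrow> nat) \<Rightarrow> (nat \<Rightarrow> nat) \<Rightarrow> (nat \<times> nat) list set" where
  "words n h u v = {g. length g = h \<and> set g \<subseteq> transposition_pairs n \<and> ascending (inv u) g \<and>
     inv (word_prod g) \<circ> u = v}"

lemma path_of_neq_Nil [simp]: "path_of u g \<noteq> []"
  by (cases g) auto

lemma hd_path_of [simp]: "hd (path_of u g) = u"
  by (cases g) auto

lemma length_path_of [simp]: "length (path_of u g) = Suc (length g)"
  by (induction g arbitrary: u) auto

lemma inv_word_prod_Cons: "inv (word_prod (t # g)) = inv (word_prod g) \<circ> tr t"
  using o_inv_distrib[OF bij_tr bij_word_prod] by simp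

lemma inv_word_prod_comp: "bij u \<Longrightarrow> inv (inv (word_prod g) \<circ> u) = inv u \<circ> word_prod g"
  using o_inv_distrib[OF bij_imp_bij_inv[OF bij_word_prod]] inv_inv_eq[OF bij_word_prod] by metis

lemma nth_path_of: "i \<le> length g \<Longrightarrow> path_of u g ! i = inv (word_prod (take i g)) \<circ> u"
proof (induction g arbitrary: u i)
  case (Cons t g)
  show ?case
  proof (cases i)
    case (Suc j)
    then have "j \<le> length g" using Cons.prems by simp
    from Cons.IH[OF this, of "tr t \<circ> u"] show ?thesis
      unfolding Suc take_Suc_Cons inv_word_prod_Cons path_of.simps nth_Cons_Suc by (simp only: comp_assoc)
  qed (simp add: id_def[symmetric])
qed (simp add: id_def[symmetric])

lemma bruhat_paths_0: "bruhat_paths n 0 u v = (if u = v then {[u]} else {})"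
  by (auto simp: bruhat_paths_def length_Suc_conv)

lemma bruhat_paths_Suc:
  "p \<in> bruhat_paths n (Suc h) u v \<longleftrightarrow>
    (\<exists>x p'. p = u # p' \<and> bruhat_edge n u x \<and> p' \<in> bruhat_paths n h x v)"
proof
  assume p: "p \<in> bruhat_paths n (Suc h) u v"
  then obtain x p'' where p'': "p = u # x # p''"
    by (auto simp: bruhat_paths_def length_Suc_conv)
  have edge: "bruhat_edge n (p ! i) (p ! Suc i)" if "i < Suc h" for i
    using p that by (simp add: bruhat_paths_def)
  have "bruhat_edge n u x" using edge[of 0] p'' by simp
  moreover have "x # p'' \<in> bruhat_paths n h x v"
    using p p'' edge[of "Suc _"] by (auto simp: bruhat_paths_def)
  ultimately show "\<exists>x p'. p = u # p' \<and> bruhat_edge n u x \<and> p' \<in> bruhat_paths n h x v"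
    using p'' by blast
next
  assume "\<exists>x p'. p = u # p' \<and> bruhat_edge n u x \<and> p' \<in> bruhat_paths n h x v"
  then show "p \<in> bruhat_paths n (Suc h) u v"
    by (auto simp: bruhat_paths_def less_Suc_eq_0_disj nth_Cons')
qed

lemma inv_tr_comp: "bij u \<Longrightarrow> inv (tr t \<circ> u) = inv u \<circ> tr t"
  using o_inv_distrib[OF bij_tr, of u t] by (simp only: inv_tr)

lemma bruhat_paths_eq_image:
  "u permutes {1..n} \<Longrightarrow> bruhat_paths n h u v = path_of u ` words n h u v"
proof (induction h arbitrary: u)
  case 0
  then show ?case by (auto simp: bruhat_paths_0 words_def id_def[symmetric])
next
  case (Suc h)
  have bij: "bij u" using Suc.prems by (rule permutes_bij)
  have step: "p' \<in> bruhat_paths n h (tr t \<circ> u) v \<longleftrightarrow> p' \<in> path_of (tr t \<circ> u) ` words n h (tr t \<circ> u) v"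
    if "t \<in> transposition_pairs n" for t p'
    unfolding Suc.IH[OF permutes_compose[OF Suc.prems tr_permutes[OF that]]] ..
  have words: "t # g \<in> words n (Suc h) u v \<longleftrightarrow> t \<in> transposition_pairs n \<and>
      inv u (fst t) < inv u (snd t) \<and> g \<in> words n h (tr t \<circ> u) v" for t g
    unfolding words_def mem_Collect_eq inv_word_prod_Cons ascending.simps inv_tr_comp[OF bij] comp_assoc
    by auto
  have "p \<in> bruhat_paths n (Suc h) u v \<longleftrightarrow> (\<exists>t g. p = path_of u (t # g) \<and> t # g \<in> words n (Suc h) u v)" for p
    unfolding bruhat_paths_Suc bruhat_edge_iff words path_of.simps using Suc.prems step by blast
  moreover have "\<exists>t g'. g = t # g'" if "g \<in> words n (Suc h) u v" for g
    using that by (cases g) (auto simp: words_def)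
  ultimately show ?case by blast
qed

lemma path_labels_Cons: "p \<noteq> [] \<Longrightarrow> path_labels (u # p) = (hd p \<circ> inv u) # path_labels p"
  by (cases p) (auto simp: path_labels_def)

lemma path_labels_path_of: "bij u \<Longrightarrow> path_labels (path_of u g) = map tr g"
proof (induction g arbitrary: u)
  case (Cons t g)
  have "(tr t \<circ> u) \<circ> inv u = tr t"
    using Cons.prems by (simp add: comp_assoc bij_is_surj surj_iff[THEN iffD1])
  moreover have "bij (tr t \<circ> u)" using Cons.prems bij_tr by (rule bij_comp)
  ultimately show ?case
    using Cons.IH[of "tr t \<circ> u"] by (simp only: path_of.simps list.map path_labels_Cons[OF path_of_neq_Nil] hd_path_of)
qed (simp add: path_labels_def)

lemma inj_on_path_of:
  assumes "u permutes {1..n}"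
  shows "inj_on (path_of u) (words n h u v)"
proof (rule inj_onI)
  fix g g' assume g: "g \<in> words n h u v" "g' \<in> words n h u v" "path_of u g = path_of u g'"
  then have "map tr g = map tr g'"
    using path_labels_path_of[OF permutes_bij[OF assms]] by metis
  moreover have "inj_on tr (set g \<union> set g')"
    using g by (intro inj_on_subset[OF inj_on_tr[of n]]) (auto simp: words_def)
  ultimately show "g = g'" by (rule map_inj_on)
qed

lemma finite_words: "finite (words n h u v)"
proof (rule finite_subset)
  show "words n h u v \<subseteq> {g. set g \<subseteq> transposition_pairs n \<and> length g = h}"
    by (auto simp: words_def)
qed (rule finite_lists_length_eq[OF finite_transposition_pairs])

lemma bruhat_edge2_iff:
  assumes x: "x permutes {1..n}"
  shows "bruhat_edge n x y \<and> bruhat_edge n y z \<longleftrightarrow>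
    (\<exists>s t. s \<in> transposition_pairs n \<and> t \<in> transposition_pairs n \<and> ascending (inv x) [s, t] \<and>
      y = tr s \<circ> x \<and> z = inv (word_prod [s, t]) \<circ> x)"
proof -
  have perm: "tr s \<circ> x permutes {1..n}" if "s \<in> transposition_pairs n" for s
    using permutes_compose[OF x tr_permutes[OF that]] .
  have prod: "inv (word_prod [s, t]) = tr t \<circ> tr s" for s t
    using inv_word_prod_Cons[of s "[t]"] inv_word_prod_Cons[of t "[]"] by simp
  have asc: "ascending (inv x) [s, t] \<longleftrightarrow> inv x (fst s) < inv x (snd s) \<and>
      inv (tr s \<circ> x) (fst t) < inv (tr s \<circ> x) (snd t)" for s t
    unfolding inv_tr_comp[OF permutes_bij[OF x]] by simp
  show ?thesis
    unfolding bruhat_edge_iff prod asc comp_assoc using perm x by blast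
qed

lemma word_prod_permutes: "set g \<subseteq> transposition_pairs n \<Longrightarrow> word_prod g permutes {1..n}"
proof (induction g)
  case Nil
  show ?case unfolding word_prod.simps by (rule permutes_id)
next
  case (Cons t g)
  then show ?case
    unfolding word_prod.simps by (intro permutes_compose tr_permutes) simp_all
qed

lemma words_flip:
  assumes g: "A @ [s, t] @ B \<in> words n h u v"
    and st': "s' \<in> transposition_pairs n" "t' \<in> transposition_pairs n"
      "word_prod [s', t'] = word_prod [s, t]" "ascending (inv u \<circ> word_prod A) [s', t']"
  shows "A @ [s', t'] @ B \<in> words n h u v"
  using g st' word_prod_flip[OF st'(3), of A B] ascending_flip[OF _ st'(3,4), of B]
  by (simp add: words_def del: word_prod.simps ascending.simps)

text \<open>\<open>flip_op\<close> overwrites one vertex, while a flip of words changes two letters.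
  They agree because all prefixes other than the one of length \<open>Suc (length A)\<close> keep
  their products.\<close>

lemma flip_op_path_of:
  assumes u: "u permutes {1..n}" and g: "A @ [s, t] @ B \<in> words n h u v"
    and st': "s' \<in> transposition_pairs n" "t' \<in> transposition_pairs n"
      "word_prod [s', t'] = word_prod [s, t]" "ascending (inv u \<circ> word_prod A) [s', t']"
    and ne: "(s', t') \<noteq> (s, t)"
  shows "flip_op n (Suc (length A)) (path_of u (A @ [s, t] @ B)) = path_of u (A @ [s', t'] @ B)"
proof -
  let ?i = "Suc (length A)" and ?p = "path_of u (A @ [s, t] @ B)" and ?q = "path_of u (A @ [s', t'] @ B)"
  define x where "x = inv (word_prod A) \<circ> u"
  have bij_u: "bij u" using u by (rule permutes_bij)
  have inv_x: "inv x = inv u \<circ> word_prod A" unfolding x_def using inv_word_prod_comp[OF bij_u] .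
  have bij_x: "bij x"
    unfolding x_def using bij_comp[OF bij_u bij_imp_bij_inv[OF bij_word_prod]] .
  have gA: "set A \<subseteq> transposition_pairs n" "s \<in> transposition_pairs n" "t \<in> transposition_pairs n"
    and asc: "ascending (inv x) [s, t]"
    using g by (auto simp: words_def ascending_append inv_x)
  have "word_prod A permutes {1..n}"
    using gA(1) by (rule word_prod_permutes)
  then have x: "x permutes {1..n}"
    unfolding x_def using u permutes_compose permutes_inv by blast
  have inv_word: "inv (word_prod (A @ [e])) \<circ> u = tr e \<circ> x" for e
  proof -
    have "inv (word_prod (A @ [e])) = tr e \<circ> inv (word_prod A)"
      using o_inv_distrib[OF bij_word_prod bij_tr, of A e]
      by (simp add: word_prod_append id_def[symmetric] del: tr_simp)
    then show ?thesis by (simp add: x_def comp_assoc)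
  qed
  have inv_word2: "inv (word_prod (A @ [e, f])) \<circ> u = inv (word_prod [e, f]) \<circ> x" for e f
    unfolding word_prod_append x_def using o_inv_distrib[OF bij_word_prod bij_word_prod] by (simp only: comp_assoc)
  have nth: "path_of u (A @ [e, f] @ B) ! length A = x"
    "path_of u (A @ [e, f] @ B) ! ?i = tr e \<circ> x"
    "path_of u (A @ [e, f] @ B) ! Suc ?i = inv (word_prod [e, f]) \<circ> x" for e f
    using inv_word[of e] inv_word2[of e f] by (simp_all add: nth_path_of x_def del: word_prod.simps)
  \<comment> \<open>Equal first letters would force equal second letters; hence the two paths differ
    at the middle vertex.\<close>
  have ne_s: "s' \<noteq> s"
  proof
    assume "s' = s"
    then have "tr s \<circ> (tr s \<circ> tr t') = tr s \<circ> (tr s \<circ> tr t)" using st'(3) by simp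
    then have "tr t' = tr t" by (simp only: comp_assoc[symmetric] tr_tr id_comp)
    then show False using inj_onD[OF inj_on_tr] gA st' ne \<open>s' = s\<close> by blast
  qed
  have tr_x: "e = f" if "tr e \<circ> x = tr f \<circ> x" "e \<in> transposition_pairs n" "f \<in> transposition_pairs n" for e f
  proof -
    have "tr e = tr f"
      using that(1) bij_x by (metis bij_is_surj comp_assoc comp_id surj_iff)
    then show ?thesis using inj_onD[OF inj_on_tr] that by blast
  qed
  let ?P = "\<lambda>y. y \<noteq> ?p ! ?i \<and> bruhat_edge n (?p ! (?i - 1)) y \<and> bruhat_edge n y (?p ! Suc ?i)"
  \<comment> \<open>A vertex \<open>y\<close> with \<open>?P y\<close> is the midpoint of an
    ascending factorization other than \<open>(s, t)\<close>, and there is just one of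
    these.\<close>
  have "(THE y. ?P y) = tr s' \<circ> x"
  proof (rule the_equality)
    have "bruhat_edge n x (tr s' \<circ> x) \<and> bruhat_edge n (tr s' \<circ> x) (inv (word_prod [s, t]) \<circ> x)"
      unfolding bruhat_edge2_iff[OF x] using st' unfolding inv_x by metis
    then show "?P (tr s' \<circ> x)" using nth tr_x[of s' s] ne_s st' gA by auto
  next
    fix y assume P: "?P y"
    then have "bruhat_edge n x y \<and> bruhat_edge n y (inv (word_prod [s, t]) \<circ> x)" using nth by simp
    then obtain s2 t2 where 2: "s2 \<in> transposition_pairs n" "t2 \<in> transposition_pairs n"
      "ascending (inv x) [s2, t2]" "y = tr s2 \<circ> x" "inv (word_prod [s, t]) \<circ> x = inv (word_prod [s2, t2]) \<circ> x"
      unfolding bruhat_edge2_iff[OF x] by blast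
    have "inv (inv (word_prod [s, t]) \<circ> x) = inv (inv (word_prod [s2, t2]) \<circ> x)" using 2(5) by (rule arg_cong)
    then have "inv x \<circ> word_prod [s, t] = inv x \<circ> word_prod [s2, t2]"
      unfolding inv_word_prod_comp[OF bij_x] .
    then have "word_prod [s, t] = word_prod [s2, t2]"
      using bij_x by (metis bij_is_surj comp_assoc id_comp surj_iff)
    moreover have "s2 \<noteq> s" using P 2(4) nth by auto
    moreover have "\<exists>!q. fst q \<in> transposition_pairs n \<and> snd q \<in> transposition_pairs n \<and>
        word_prod [fst q, snd q] = word_prod [s, t] \<and> ascending (inv x) [fst q, snd q] \<and> q \<noteq> (s, t)"
      by (rule flip_exists_unique[OF _ gA(2,3) asc]) (rule bij_is_inj[OF bij_imp_bij_inv[OF bij_x]])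
    ultimately have "(s2, t2) = (s', t')"
      using 2 st' ne unfolding inv_x by (metis fst_conv snd_conv)
    then show "y = tr s' \<circ> x" using 2 by simp
  qed
  then have flip: "flip_op n ?i ?p = ?p[?i := tr s' \<circ> x]" unfolding flip_op_def by simp
  show ?thesis
    unfolding flip
  proof (rule nth_equalityI)
    fix j assume "j < length (?p[?i := tr s' \<circ> x])"
    then have j: "j \<le> length (A @ [s, t] @ B)" "j \<le> length (A @ [s', t'] @ B)" by simp_all
    consider "j \<le> length A" | "j = ?i" | "Suc ?i \<le> j" by linarith
    then show "?p[?i := tr s' \<circ> x] ! j = ?q ! j"
    proof cases
      case 1
      then show ?thesis using j by (simp add: nth_path_of)
    next
      case 2
      then show ?thesis using nth(2)[of s' t'] by simp
    next
      case 3
      define k where "k = j - (length A + 2)"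
      have k: "j = length A + 2 + k" using 3 by (simp add: k_def)
      have take: "take j (A @ [e, f] @ B) = A @ [e, f] @ take k B" for e f
        unfolding k by simp
      have "word_prod (take j (A @ [s', t'] @ B)) = word_prod (take j (A @ [s, t] @ B))"
        unfolding take by (rule word_prod_flip[OF st'(3)])
      then show ?thesis using 3 j nth_path_of[OF j(1), of u] nth_path_of[OF j(2), of u] by simp
    qed
  qed simp
qed

lemma flipclass_words:
  assumes u: "u permutes {1..n}" and F: "is_flipclass n h u v F"
  obtains G where "F = path_of u ` G" "G \<subseteq> words n h u v" "flip_closed n (inv u) G"
proof -
  from F obtain p0 where p0: "p0 \<in> bruhat_paths n h u v" and F_eq: "F = {q. (p0, q) \<in> (flip_step n h u v)\<^sup>*}"
    unfolding is_flipclass_def by blast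
  define G where "G = {g \<in> words n h u v. path_of u g \<in> F}"
  have inj: "inj (inv u \<circ> word_prod A)" for A
    using bij_is_inj[OF bij_comp[OF bij_word_prod bij_imp_bij_inv[OF permutes_bij[OF u]]]] .
  \<comment> \<open>Flips do not leave the set of paths: the vertex chosen by \<open>flip_op\<close>
    comes from the second ascending factorization, which \<open>flip_exists_unique\<close>
    provides.\<close>
  have "q \<in> path_of u ` words n h u v" if "(p0, q) \<in> (flip_step n h u v)\<^sup>*" for q
    using that
  proof (induction rule: rtrancl_induct)
    case base
    then show ?case using p0 bruhat_paths_eq_image[OF u] by simp
  next
    case (step p q)
    then obtain g i where g: "p = path_of u g" "g \<in> words n h u v"
      and i: "1 \<le> i" "i \<le> h - 1" "q = flip_op n i p"
      by (auto simp: flip_step_def)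
    have len: "length g = h" using g by (simp add: words_def)
    define A B where "A = take (i - 1) g" and "B = drop (i + 1) g"
    have g_eq: "g = A @ [g ! (i - 1), g ! i] @ B"
    proof -
      have "drop (i - 1) g = g ! (i - 1) # g ! i # B"
        using Cons_nth_drop_Suc[of "i - 1" g] Cons_nth_drop_Suc[of i g] i len by (simp add: B_def)
      then show ?thesis using append_take_drop_id[of "i - 1" g] by (simp add: A_def)
    qed
    obtain s t where st: "g = A @ [s, t] @ B" using g_eq by blast
    have lenA: "i = Suc (length A)" using i len by (simp add: A_def)
    have st_in: "s \<in> transposition_pairs n" "t \<in> transposition_pairs n" "ascending (inv u \<circ> word_prod A) [s, t]"
      using g(2) unfolding st by (auto simp: words_def ascending_append)
    obtain r where r: "fst r \<in> transposition_pairs n" "snd r \<in> transposition_pairs n"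
        "word_prod [fst r, snd r] = word_prod [s, t]" "ascending (inv u \<circ> word_prod A) [fst r, snd r]" "r \<noteq> (s, t)"
      using flip_exists_unique[OF inj st_in] by blast
    have "q = path_of u (A @ [fst r, snd r] @ B)"
      using flip_op_path_of[OF u g(2)[unfolded st] r(1-4)] r(5) i(3) lenA g(1) st by simp
    then show ?case using words_flip[OF g(2)[unfolded st] r(1-4)] by blast
  qed
  then have "F = path_of u ` G" unfolding F_eq G_def by blast
  moreover have "G \<subseteq> words n h u v" unfolding G_def by blast
  moreover have "flip_closed n (inv u) G"
    unfolding flip_closed_def
  proof (intro allI impI)
    fix A s t s' t' B
    assume g: "A @ [s, t] @ B \<in> G" and st': "s' \<in> transposition_pairs n" "t' \<in> transposition_pairs n"
      "word_prod [s', t'] = word_prod [s, t]" "ascending (inv u \<circ> word_prod A) [s', t']"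
    have gw: "A @ [s, t] @ B \<in> words n h u v" and gF: "path_of u (A @ [s, t] @ B) \<in> F"
      using g by (auto simp: G_def)
    show "A @ [s', t'] @ B \<in> G"
    proof (cases "(s', t') = (s, t)")
      case False
      have "length (A @ [s, t] @ B) = h" using gw unfolding words_def by blast
      then have "Suc (length A) \<le> h - 1" by simp
      moreover have "path_of u (A @ [s, t] @ B) \<in> bruhat_paths n h u v"
        unfolding bruhat_paths_eq_image[OF u] using gw by (rule imageI)
      ultimately have "(path_of u (A @ [s, t] @ B), path_of u (A @ [s', t'] @ B)) \<in> flip_step n h u v"
        unfolding flip_step_def using flip_op_path_of[OF u gw st' False, symmetric] by force
      then have "path_of u (A @ [s', t'] @ B) \<in> F"
        using gF unfolding F_eq by (auto intro: rtrancl_into_rtrancl)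
      then show ?thesis using words_flip[OF gw st'] by (simp add: G_def)
    qed (use g in simp)
  qed
  ultimately show ?thesis using that by blast
qed

section \<open>Reflection orderings as lists\<close>

lemma ascending_distinct_adj: "ascending w g \<Longrightarrow> distinct_adj g"
proof (induction g arbitrary: w rule: induct_list012)
  case (3 s t g)
  \<comment> \<open>After the step \<open>s\<close> the values at its two entries are in descending
    order, so \<open>s\<close> cannot be repeated at once. Thus \<open>increasing_path\<close>,
    stated with a reflexive relation, amounts to strict increase.\<close>
  have "s \<noteq> t" using 3(3) by (auto simp: tr_def)
  moreover have "ascending (w \<circ> tr s) (t # g)" using 3(3) unfolding ascending.simps(2)[of w] by blast
  then have "distinct_adj (t # g)" by (rule 3(2))
  ultimately show ?case by simp
qed auto

lemma ex_sorted_wrt_list: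
  assumes "finite A" and trans: "transp P" and total: "totalp_on A P"
  shows "\<exists>L. set L = A \<and> distinct L \<and> sorted_wrt P L"
  using assms(1,3)
proof (induction A rule: finite_induct)
  case (insert x A)
  then obtain L where L: "set L = A" "distinct L" "sorted_wrt P L"
    by (auto dest: totalp_on_subset[of _ _ A])
  have "P y x \<or> P x y" if "y \<in> set L" for y
    using insert.prems insert.hyps that L by (auto simp: totalp_on_def)
  then have "sorted_wrt P (filter (\<lambda>y. P y x) L @ [x] @ filter (\<lambda>y. \<not> P y x) L)"
    using L trans by (auto simp: sorted_wrt_append sorted_wrt_filter dest: transpD)
  moreover have "set (filter (\<lambda>y. P y x) L @ [x] @ filter (\<lambda>y. \<not> P y x) L) = insert x A"
    using L by auto
  moreover have "distinct (filter (\<lambda>y. P y x) L @ [x] @ filter (\<lambda>y. \<not> P y x) L)"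
    using L insert.hyps by auto
  ultimately show ?case by blast
qed simp

lemma subseq_sorted_wrt: "subseq g L \<Longrightarrow> sorted_wrt P L \<Longrightarrow> sorted_wrt P g"
  by (induction rule: list_emb.induct) (auto elim: list_emb_set)

text \<open>By asymmetry the head of \<open>L\<close> can occur in a sorted \<open>g\<close> only as
  its first letter, so it is either matched there or skipped.\<close>

lemma subseq_iff_sorted_wrt:
  assumes "asymp P" "sorted_wrt P L" "set g \<subseteq> set L"
  shows "subseq g L \<longleftrightarrow> sorted_wrt P g"
proof
  assume "sorted_wrt P g"
  then show "subseq g L"
    using assms(2,3)
  proof (induction L arbitrary: g)
    case (Cons x L)
    show ?case
    proof (cases g)
      case g: (Cons y g')
      show ?thesis
      proof (cases "y = x")
        case True
        have "x \<notin> set g'" using Cons.prems(1) assms(1) unfolding g True by (auto dest: asympD)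
        then have "subseq g' L" using Cons.IH[of g'] Cons.prems unfolding g by auto
        then show ?thesis by (simp add: g True)
      next
        case False
        then have "P x y" using Cons.prems(2,3) unfolding g by auto
        then have "x \<notin> set g'" using Cons.prems(1) assms(1) unfolding g by (auto dest: asympD)
        then have "subseq g L" using Cons.IH[of g] Cons.prems False unfolding g by auto
        then show ?thesis by (rule list_emb_Cons)
      qed
    qed simp
  qed simp
qed (rule subseq_sorted_wrt[OF _ assms(2)])

lemma reflection_ordering_list:
  assumes r: "reflection_ordering n r"
  obtains L where "reflection_list n L"
    "\<And>u g. u permutes {1..n} \<Longrightarrow> set g \<subseteq> transposition_pairs n \<Longrightarrow> ascending (inv u) g \<Longrightarrow>
      increasing_path r (path_of u g) \<longleftrightarrow> subseq g L"
proof -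
  let ?T = "transposition_pairs n"
  \<comment> \<open>The strict part of \<open>r\<close>, carried over to pairs: strictness gives the
    asymmetry that \<open>subseq_iff_sorted_wrt\<close> asks for, and on \<open>?T\<close> the map
    \<open>tr\<close> is injective.\<close>
  define P where "P s t \<longleftrightarrow> s \<in> ?T \<and> t \<in> ?T \<and> s \<noteq> t \<and> (tr s, tr t) \<in> r" for s t
  have lin: "trans r" "antisym r" "total_on (transpositions n) r"
    using r by (auto simp: reflection_ordering_def linear_order_on_def partial_order_on_def preorder_on_def)
  have tr_eq: "s = t" if "s \<in> ?T" "t \<in> ?T" "tr s = tr t" for s t
    using inj_onD[OF inj_on_tr] that by blast
  have asym: "\<not> P t s" if "P s t" for s t
    using that tr_eq lin(2) unfolding P_def by (metis antisymD)
  then have asymp: "asymp P" by (rule asympI)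
  have "transp P"
  proof (rule transpI)
    fix s t q assume P: "P s t" "P t q"
    then have "s \<noteq> q" using asym by blast
    then show "P s q" using P lin(1) unfolding P_def by (meson transD)
  qed
  moreover have "totalp_on ?T P"
  proof (rule totalp_onI)
    fix s t assume "s \<in> ?T" "t \<in> ?T" "s \<noteq> t"
    then show "P s t \<or> P t s"
      using lin(3) tr_eq unfolding P_def total_on_def transpositions_eq_image by blast
  qed
  ultimately obtain L where L: "set L = ?T" "distinct L" "sorted_wrt P L"
    using ex_sorted_wrt_list[OF finite_transposition_pairs] by blast
  have "filter (\<lambda>t. t \<in> {(a, b), (a, c), (b, c)}) L \<in> {[(a, b), (a, c), (b, c)], [(b, c), (a, c), (a, b)]}"
    if abc: "1 \<le> a \<and> a < b \<and> b < c \<and> c \<le> n" for a b c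
  proof -
    have T: "{(a, b), (a, c), (b, c)} \<subseteq> ?T" using abc by (auto simp: transposition_pairs_def)
    \<comment> \<open>\<open>[x, y, z]\<close> is a subsequence of the filtered list and has the
      same length, so the two coincide.\<close>
    have sorted3: "filter (\<lambda>t. t \<in> {(a, b), (a, c), (b, c)}) L = [x, y, z]"
      if xyz: "P x y" "P y z" and set: "{x, y, z} = {(a, b), (a, c), (b, c)}" for x y z
    proof -
      let ?Q = "\<lambda>t. t \<in> {x, y, z}"
      have "P x z" using xyz \<open>transp P\<close> by (meson transpD)
      then have dist: "distinct [x, y, z]" and sort: "sorted_wrt P [x, y, z]"
        using xyz by (auto simp: P_def)
      have "subseq [x, y, z] L"
        using subseq_iff_sorted_wrt[OF asymp L(3), of "[x, y, z]"] sort T set L(1) by simp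
      then have "subseq (filter ?Q [x, y, z]) (filter ?Q L)" by (rule subseq_filter)
      then have "subseq [x, y, z] (filter ?Q L)" by simp
      moreover have "length (filter ?Q L) = length [x, y, z]"
      proof -
        have "length (filter ?Q L) = card (set (filter ?Q L))"
          using L(2) by (simp only: distinct_card distinct_filter)
        also have "set (filter ?Q L) = set [x, y, z]" using T set L(1) by auto
        also have "card \<dots> = length [x, y, z]" using dist by (rule distinct_card)
        finally show ?thesis .
      qed
      ultimately have "filter ?Q L = [x, y, z]" by (metis subseq_same_length)
      then show ?thesis unfolding set .
    qed
    have "(tr (a, b), tr (a, c)) \<in> r \<and> (tr (a, c), tr (b, c)) \<in> r \<or>
        (tr (b, c), tr (a, c)) \<in> r \<and> (tr (a, c), tr (a, b)) \<in> r"
      using r abc unfolding reflection_ordering_def tr_simp by blast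
    then have "P (a, b) (a, c) \<and> P (a, c) (b, c) \<or> P (b, c) (a, c) \<and> P (a, c) (a, b)"
      using T abc by (auto simp: P_def simp del: tr_simp)
    then show ?thesis
      using sorted3[of "(a, b)" "(a, c)" "(b, c)"] sorted3[of "(b, c)" "(a, c)" "(a, b)"] by blast
  qed
  then have "reflection_list n L" using L by (simp add: reflection_list_def)
  moreover have "increasing_path r (path_of u g) \<longleftrightarrow> subseq g L"
    if u: "u permutes {1..n}" and g: "set g \<subseteq> ?T" "ascending (inv u) g" for u g
  proof -
    have labels: "path_labels (path_of u g) = map tr g"
      by (rule path_labels_path_of[OF permutes_bij[OF u]])
    have "g ! i \<noteq> g ! Suc i" if "Suc i < length g" for i
      using ascending_distinct_adj[OF g(2)] that by (simp add: distinct_adj_conv_nth)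
    moreover have "g ! i \<in> ?T" if "i < length g" for i using g(1) that by (meson nth_mem subsetD)
    ultimately have "increasing_path r (path_of u g) \<longleftrightarrow> (\<forall>i. Suc i < length g \<longrightarrow> P (g ! i) (g ! Suc i))"
      unfolding increasing_path_def labels P_def by (auto simp del: tr_simp)
    also have "\<dots> \<longleftrightarrow> sorted_wrt P g"
      by (rule sorted_wrt_iff_nth_Suc_transp[OF \<open>transp P\<close>, symmetric])
    also have "\<dots> \<longleftrightarrow> subseq g L"
      using subseq_iff_sorted_wrt[OF asymp L(3), of g] g(1) L(1) by simp
    finally show ?thesis .
  qed
  ultimately show ?thesis using that by blast
qed

theorem theorem4p1:
  fixes n h :: nat and u v :: "nat \<Rightarrow> nat" and F :: "(nat \<Rightarrow> nat) list set"
    and r r' :: "((nat \<Rightarrow> nat) \<times> (nat \<Rightarrow> nat)) set"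
  assumes "u \<in> sym_group n" and "v \<in> sym_group n"
    and "is_flipclass n h u v F"
    and "reflection_ordering n r" and "reflection_ordering n r'"
  shows "card {p \<in> F. increasing_path r p} = card {p \<in> F. increasing_path r' p}"
proof -
  have u: "u permutes {1..n}" using assms(1) by (simp add: sym_group_def)
  obtain G where G: "F = path_of u ` G" "G \<subseteq> words n h u v" "flip_closed n (inv u) G"
    using flipclass_words[OF u assms(3)] .
  have fin: "finite G" using G(2) finite_words by (rule finite_subset)
  have asc: "ascending (inv u) g" "set g \<subseteq> transposition_pairs n" if "g \<in> G" for g
    using G(2) that by (auto simp: words_def)
  have inj: "inj (inv u)" using bij_is_inj[OF bij_imp_bij_inv[OF permutes_bij[OF u]]] .
  \<comment> \<open>The right-hand side does not mention \<open>r\<close>, so both orderings are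
    compared with the same number.\<close>
  have "card {p \<in> F. increasing_path r p} = card {g \<in> G. subseq g (lex_list n)}"
    if r: "reflection_ordering n r" for r
  proof -
    obtain L where L: "reflection_list n L"
      "\<And>g. set g \<subseteq> transposition_pairs n \<Longrightarrow> ascending (inv u) g \<Longrightarrow>
        increasing_path r (path_of u g) \<longleftrightarrow> subseq g L"
      using reflection_ordering_list[OF r] u by metis
    have "{p \<in> F. increasing_path r p} = path_of u ` {g \<in> G. subseq g L}"
      unfolding G(1) using L(2) asc by auto
    moreover have "inj_on (path_of u) {g \<in> G. subseq g L}"
      using G(2) by (intro inj_on_subset[OF inj_on_path_of[OF u]]) auto
    ultimately have "card {p \<in> F. increasing_path r p} = card {g \<in> G. subseq g L}"
      by (simp add: card_image)
    also have "\<dots> = card {g \<in> G. subseq g (lex_list n)}"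
      by (rule card_subseq_braid_moves[OF braid_moves_lex_list[OF L(1)] L(1) inj fin G(3) asc(1)])
    finally show ?thesis .
  qed
  then show ?thesis using assms(4,5) by simp
qed

end
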